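(* Let $(\Omega,\mathcal{F},(\mathcal{F}_t)_{t\geq 0},\mathbb{P})$ be a complete filtered probability space, let $N$ be a simple point process corresponding to a sequence of $(\mathcal{F}_t)$-stopping times $(T_n)_{n=0}^\infty$, and let $X$ be a non-negative, locally integrable, $\mathcal{F}_0$-measurable process. Then the following statements are equivalent: (i) $N$ is a conditional Poisson process with $\mathcal{F}_0$-measurable intensity $X$, i.e. for all $u\in\mathbb{R}$ and all $t\geq r\geq 0$, almost surely $$\mathbb{E}\Big[\exp\big(iu(N_t-N_r)\big)\,\Big|\,\mathcal{F}_r\Big]=\exp\Big((\mathrm{e}^{iu}-1)\int_r^t X_s\,\mathrm{d}s\Big).$$ (ii) The process $\widetilde{N}_t=N_t-\int_0^t X_s\,\mathrm{d}s$, $t\geq 0$, is a local $(\mathcal{F}_t)$-martingale.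
   Context: Conventions: $\mathbb{N}=\{1,2,\dots\}$ and $\mathbb{N}_0=\{0,1,2,\dots\}$. Simple point process: the process $N$ corresponding to $(\mathcal{F}_t)$-stopping times $(T_n)_{n=0}^\infty$ with values in $[0,\infty]$ is $$N_t=\sum_{n\in\mathbb{N}}\mathbf{1}_{\{T_n\leq t\}},\quad t\geq 0,$$ where $\mathbb{P}[T_0=0]=1$ and, for every $n\in\mathbb{N}_0$, $\mathbb{P}\big[T_{n+1}<\infty\Rightarrow T_n<T_{n+1}\big]=1$. The process $X$: "$\mathcal{F}_0$-measurable process" means that $X:[0,\infty)\times\Omega\to[0,\infty)$ is $\mathcal{B}([0,\infty))\otimes\mathcal{F}_0$-measurable. "Locally integrable" means $\mathbb{P}\big[\int_0^t X_s\,\mathrm{d}s<\infty\ \ \forall\, t\geq 0\big]=1$. Both (i) and (ii) implicitly entail that $N_t<\infty$ almost surely for all $t\geq 0$. No integrability of $N_t$ or of $\int_0^t X_s\,\mathrm{d}s$ is assumed. *)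

theory Defs
  imports "HOL-Probability.Probability"
begin

text \<open>Time is \<open>real\<close>, but only the indices \<open>t \<ge> 0\<close> matter; values of filtrations and processes at
  negative times are junk and are never constrained. Completeness means that the measure is
  complete and that all null sets lie in \<open>F 0\<close>; right-continuity is not required.\<close>

locale complete_filtered_prob_space = prob_space M + complete_measure M
  for M :: "'a measure" +
  fixes F :: "real \<Rightarrow> 'a measure"
  assumes subalgebra_F: "\<And>t. 0 \<le> t \<Longrightarrow> subalgebra M (F t)"
    and mono_F: "\<And>s t. 0 \<le> s \<Longrightarrow> s \<le> t \<Longrightarrow> sets (F s) \<subseteq> sets (F t)"
    and null_sets_F: "null_sets M \<subseteq> sets (F 0)"

text \<open>The library's \<open>stopping_time\<close> uses one type for both time indices and values; here the indices
  are finite while the value \<open>\<infinity>\<close> is allowed.\<close>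

definition ext_stopping_time :: "(real \<Rightarrow> 'a measure) \<Rightarrow> ('a \<Rightarrow> ennreal) \<Rightarrow> bool" where
  "ext_stopping_time F T \<longleftrightarrow> (\<forall>t\<ge>0. Measurable.pred (F t) (\<lambda>\<omega>. T \<omega> \<le> ennreal t))"

definition point_process_times ::
  "'a measure \<Rightarrow> (real \<Rightarrow> 'a measure) \<Rightarrow> (nat \<Rightarrow> 'a \<Rightarrow> ennreal) \<Rightarrow> bool" where
  "point_process_times M F T \<longleftrightarrow>
     (\<forall>n. ext_stopping_time F (T n)) \<and>
     (AE \<omega> in M. T 0 \<omega> = 0) \<and>
     (\<forall>n. AE \<omega> in M. T (Suc n) \<omega> < \<infinity> \<longrightarrow> T n \<omega> < T (Suc n) \<omega>)"

text \<open>The sum starts at \<open>T 1\<close>: the time \<open>T 0\<close> is not counted.\<close>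

definition simple_point_process :: "(nat \<Rightarrow> 'a \<Rightarrow> ennreal) \<Rightarrow> real \<Rightarrow> 'a \<Rightarrow> ennreal" where
  "simple_point_process T t \<omega> = (\<Sum>n. indicator {\<omega>. T (Suc n) \<omega> \<le> ennreal t} \<omega>)"

definition F0_measurable_process :: "(real \<Rightarrow> 'a measure) \<Rightarrow> (real \<Rightarrow> 'a \<Rightarrow> real) \<Rightarrow> bool" where
  "F0_measurable_process F X \<longleftrightarrow>
     (\<lambda>(s, \<omega>). X s \<omega>) \<in> borel_measurable (restrict_space borel {0..} \<Otimes>\<^sub>M F 0)"

definition nonneg_process :: "'a measure \<Rightarrow> (real \<Rightarrow> 'a \<Rightarrow> real) \<Rightarrow> bool" where
  "nonneg_process M X \<longleftrightarrow> (\<forall>s\<ge>0. \<forall>\<omega>\<in>space M. 0 \<le> X s \<omega>)"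

definition locally_integrable :: "'a measure \<Rightarrow> (real \<Rightarrow> 'a \<Rightarrow> real) \<Rightarrow> bool" where
  "locally_integrable M X \<longleftrightarrow>
     (AE \<omega> in M. \<forall>t\<ge>0. (\<integral>\<^sup>+ s\<in>{0..t}. ennreal (X s \<omega>) \<partial>lborel) < \<infinity>)"

text \<open>The library provides conditional expectations of real-valued functions only.\<close>

definition complex_cond_exp ::
  "'a measure \<Rightarrow> 'a measure \<Rightarrow> ('a \<Rightarrow> complex) \<Rightarrow> 'a \<Rightarrow> complex" where
  "complex_cond_exp M G Z \<omega> =
     Complex (real_cond_exp M G (\<lambda>\<omega>. Re (Z \<omega>)) \<omega>) (real_cond_exp M G (\<lambda>\<omega>. Im (Z \<omega>)) \<omega>)"

text \<open>The counting process \<open>N\<close> may a priori take the value \<open>\<infinity>\<close>. Both the conditional Poisson property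
  and the local martingale property of the compensated process only make sense when it is almost
  surely finite, so finiteness is an explicit part of each; \<open>enn2real\<close> then changes \<open>N\<close> at most on
  a null set.\<close>

definition finite_process :: "'a measure \<Rightarrow> (real \<Rightarrow> 'a \<Rightarrow> ennreal) \<Rightarrow> bool" where
  "finite_process M N \<longleftrightarrow> (\<forall>t\<ge>0. AE \<omega> in M. N t \<omega> < \<infinity>)"

definition conditional_poisson_process ::
  "'a measure \<Rightarrow> (real \<Rightarrow> 'a measure) \<Rightarrow> (real \<Rightarrow> 'a \<Rightarrow> ennreal) \<Rightarrow> (real \<Rightarrow> 'a \<Rightarrow> real) \<Rightarrow> bool" where
  "conditional_poisson_process M F N X \<longleftrightarrow>
     finite_process M N \<and>
     (\<forall>u::real. \<forall>r t. 0 \<le> r \<longrightarrow> r \<le> t \<longrightarrow>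
        (AE \<omega> in M.
           complex_cond_exp M (F r)
             (\<lambda>\<omega>. exp (\<i> * of_real (u * (enn2real (N t \<omega>) - enn2real (N r \<omega>))))) \<omega>
           = exp ((exp (\<i> * of_real u) - 1) * of_real (LBINT s:{r..t}. X s \<omega>))))"

definition compensated_process ::
  "(real \<Rightarrow> 'a \<Rightarrow> ennreal) \<Rightarrow> (real \<Rightarrow> 'a \<Rightarrow> real) \<Rightarrow> real \<Rightarrow> 'a \<Rightarrow> real" where
  "compensated_process N X t \<omega> = enn2real (N t \<omega>) - (LBINT s:{0..t}. X s \<omega>)"

definition adapted_process :: "(real \<Rightarrow> 'a measure) \<Rightarrow> (real \<Rightarrow> 'a \<Rightarrow> real) \<Rightarrow> bool" where
  "adapted_process F Y \<longleftrightarrow> (\<forall>t\<ge>0. Y t \<in> borel_measurable (F t))"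

definition martingale :: "'a measure \<Rightarrow> (real \<Rightarrow> 'a measure) \<Rightarrow> (real \<Rightarrow> 'a \<Rightarrow> real) \<Rightarrow> bool" where
  "martingale M F Y \<longleftrightarrow>
     adapted_process F Y \<and>
     (\<forall>t\<ge>0. integrable M (Y t)) \<and>
     (\<forall>s t. 0 \<le> s \<longrightarrow> s \<le> t \<longrightarrow> (AE \<omega> in M. real_cond_exp M (F s) (Y t) \<omega> = Y s \<omega>))"

definition cadlag :: "(real \<Rightarrow> real) \<Rightarrow> bool" where
  "cadlag f \<longleftrightarrow>
     (\<forall>t\<ge>0. (f \<longlongrightarrow> f t) (at_right t)) \<and> (\<forall>t>0. \<exists>l. (f \<longlongrightarrow> l) (at_left t))"

definition stopped_process ::
  "(real \<Rightarrow> 'a \<Rightarrow> real) \<Rightarrow> ('a \<Rightarrow> ennreal) \<Rightarrow> real \<Rightarrow> 'a \<Rightarrow> real" where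
  "stopped_process Y \<tau> t \<omega> = Y (enn2real (min (ennreal t) (\<tau> \<omega>))) \<omega>"

definition local_martingale ::
  "'a measure \<Rightarrow> (real \<Rightarrow> 'a measure) \<Rightarrow> (real \<Rightarrow> 'a \<Rightarrow> real) \<Rightarrow> bool" where
  "local_martingale M F Y \<longleftrightarrow>
     adapted_process F Y \<and>
     (AE \<omega> in M. cadlag (\<lambda>t. Y t \<omega>)) \<and>
     (\<exists>\<tau> :: nat \<Rightarrow> 'a \<Rightarrow> ennreal.
        (\<forall>n. ext_stopping_time F (\<tau> n)) \<and>
        (AE \<omega> in M. incseq (\<lambda>n. \<tau> n \<omega>) \<and> (\<lambda>n. \<tau> n \<omega>) \<longlonglongrightarrow> \<infinity>) \<and>
        (\<forall>n. martingale M F (stopped_process Y (\<tau> n))))"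

end

theory Submission
  imports Defs
begin

text \<open>Write \<open>A t\<close> for the integral of \<open>X\<close> over \<open>[0, t]\<close>. Both properties are equivalent to a statement about
  means on events of \<open>F r\<close> on which \<open>A t\<close> is bounded: there \<open>N t\<close> is integrable and \<open>N t - N r\<close> and
  \<open>A t - A r\<close> have the same mean. This follows from the characteristic function by letting \<open>u\<close> tend to
  \<open>0\<close> (Fatou for the second moment, then dominated convergence). Conversely, with \<open>c = exp (\<i> u) - 1\<close>, one
  telescopes \<open>exp (\<i> u (N s - N r)) * exp (c (A t - A s))\<close> along a partition of \<open>[r, t]\<close>. Up to the mean
  zero terms \<open>c (\<Delta>N - \<Delta>A)\<close>, the increments are bounded by a constant times \<open>\<Delta>N 1{\<Delta>N \<ge> 2} + (\<Delta>A)\<^sup>2\<close>,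
  whose sum tends to \<open>0\<close> with the mesh because \<open>N\<close> has isolated unit jumps and \<open>A\<close> is continuous. Passing
  between the means and the local martingale property needs only the boundedness of \<open>A\<close>, an
  \<open>F 0\<close>-measurable condition.\<close>

section \<open>Characteristic functions along a partition\<close>

text \<open>The telescoping sum takes the place of Ito's formula:
  \<open>exp (\<i> u (N s - N r)) * exp (c (A t - A s))\<close> moves from the compensator term at
  \<open>s = r\<close> to the term of \<open>N\<close> at \<open>s = t\<close>, so it suffices that
  its mean on events of \<open>F r\<close> does not change. The second factor looks ahead to time
  \<open>t\<close>. It is an admissible weight for the increments of \<open>N - A\<close> after
  \<open>s\<close> because \<open>A\<close> is known at time \<open>0\<close>; this is where
  measurability with respect to \<open>F 0\<close>, rather than mere adaptedness, enters. Its norm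
  is at most \<open>1\<close>, as \<open>Re c = cos u - 1\<close> is nonpositive and
  \<open>A\<close> increases. The other obstacle is that neither \<open>N t\<close> nor
  \<open>A t\<close> need be integrable. Events on which \<open>A t \<le> K\<close> supply the
  integrability of \<open>N t\<close> in either direction, and since \<open>A t \<le> K\<close> is
  an event of \<open>F 0\<close>, it may be intersected with any event of \<open>F r\<close>. On the
  side of characteristic functions the truncation is removed by boundedness; on the martingale side
  it turns into the localizing sequence.\<close>

lemma norm_exp_sub_linear_le:
  fixes z :: complex
  assumes "Re z \<le> 0"
  shows "norm (exp z - 1 - z) \<le> (norm z)\<^sup>2"
proof -
  \<comment> \<open>Taylor's formula on the half-plane \<open>Re z \<le> 0\<close>, which is convex
    and contains \<open>0\<close>. There \<open>exp\<close> is bounded by \<open>1\<close>, so the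
    quadratic bound needs no restriction on the size of \<open>z\<close>.\<close>
  have "norm (exp z - (\<Sum>i\<le>1. exp 0 * (z - 0) ^ i / fact i)) \<le> 1 * norm (z - 0) ^ (Suc 1) / fact 1"
  proof (rule complex_Taylor[of "{z. Re z \<le> 0}" 1 "\<lambda>i. exp"])
    show "convex {z. Re z \<le> 0}" by (rule convex_halfspace_Re_le)
    show "(exp has_field_derivative exp x) (at x within {z. Re z \<le> 0})" for x :: complex
      by (auto intro!: derivative_eq_intros)
  qed (use assms in auto)
  then show ?thesis
    by (simp add: diff_diff_eq power2_eq_square)
qed

lemma telescoping_characteristic_sum:
  fixes x y :: "nat \<Rightarrow> real" and u :: real
  defines "c \<equiv> exp (\<i> * of_real u) - 1"
  shows "(\<Sum>j<m. exp (\<i> * of_real (u * (x j - x 0))) * exp (c * of_real (y m - y (Suc j))) *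
            (exp (\<i> * of_real (u * (x (Suc j) - x j))) - exp (c * of_real (y (Suc j) - y j))))
         = exp (\<i> * of_real (u * (x m - x 0))) - exp (c * of_real (y m - y 0))"
proof -
  \<comment> \<open>\<open>Z\<close> exchanges the two exponentials one interval at a time:
    \<open>Z 0\<close> is the one of the total increment of \<open>y\<close>, and \<open>Z m\<close>
    the one of the total increment of \<open>x\<close>.\<close>
  define Z where "Z j = exp (\<i> * of_real (u * (x j - x 0))) * exp (c * of_real (y m - y j))" for j
  have "exp (\<i> * of_real (u * (x j - x 0))) * exp (c * of_real (y m - y (Suc j))) *
            (exp (\<i> * of_real (u * (x (Suc j) - x j))) - exp (c * of_real (y (Suc j) - y j)))
        = Z (Suc j) - Z j" for j
    unfolding Z_def by (simp add: right_diff_distrib mult_exp_exp algebra_simps)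
  then show ?thesis
    by (simp add: sum_lessThan_telescope) (simp add: Z_def)
qed

text \<open>The function \<open>exp (\<i> u d)\<close> and its chord \<open>1 + c d\<close> agree at
  \<open>d = 0\<close> and \<open>d = 1\<close>, so linearising costs nothing unless an interval
  contains at least two jumps. Then \<open>2 + 2 d \<le> 4 d\<close> is enough, since both
  \<open>exp (\<i> u d) - 1\<close> and \<open>c\<close> have norm at most \<open>2\<close>.\<close>

lemma norm_exp_nat_step_le:
  fixes d u :: real
  assumes "d \<in> \<nat>"
  shows "norm (exp (\<i> * of_real (u * d)) - 1 - (exp (\<i> * of_real u) - 1) * of_real d)
         \<le> 4 * (if d \<le> 1 then 0 else d)"
proof -
  obtain k where k: "d = real k" using assms by (auto elim: Nats_cases)
  show ?thesis
  proof (cases "k \<le> 1")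
    case True
    then have "k = 0 \<or> k = 1" by auto
    then show ?thesis using k by auto
  next
    case False
    have 1: "norm (exp (\<i> * of_real (u * d)) - 1) \<le> 2"
      by (rule norm_triangle_le_diff) (simp add: norm_exp_i_times)
    have "norm (exp (\<i> * of_real u) - 1) \<le> 2"
      by (rule norm_triangle_le_diff) (simp add: norm_exp_i_times)
    then have 2: "norm ((exp (\<i> * of_real u) - 1) * of_real d) \<le> 2 * d"
      unfolding norm_mult norm_of_real using k by (simp add: mult_right_mono)
    have "norm (exp (\<i> * of_real (u * d)) - 1 - (exp (\<i> * of_real u) - 1) * of_real d) \<le> 2 + 2 * d"
      by (rule norm_triangle_le_diff[OF add_mono[OF 1 2]])
    moreover have "2 \<le> d" using False k by simp
    ultimately show ?thesis by simp
  qed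
qed

text \<open>The weights in front of the differences have norm at most \<open>1\<close>, because
  \<open>y\<close> increases and \<open>Re c \<le> 0\<close>. So the error is bounded by the sum of
  two linearisation errors per interval, one from multiple jumps of \<open>x\<close> and one
  quadratic in the increment of \<open>y\<close>. The factor \<open>4\<close> of the latter is the
  square of the bound \<open>2\<close> on the norm of \<open>c\<close>.\<close>

lemma norm_characteristic_remainder_le:
  fixes x y :: "nat \<Rightarrow> real" and u :: real
  defines "c \<equiv> exp (\<i> * of_real u) - 1"
  assumes x: "\<And>j. j < m \<Longrightarrow> x (Suc j) - x j \<in> \<nat>"
    and y: "\<And>i j. i \<le> j \<Longrightarrow> j \<le> m \<Longrightarrow> y i \<le> y j"
  shows "norm (exp (\<i> * of_real (u * (x m - x 0))) - exp (c * of_real (y m - y 0))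
           - (\<Sum>j<m. exp (\<i> * of_real (u * (x j - x 0))) * exp (c * of_real (y m - y (Suc j))) *
               c * of_real ((x (Suc j) - x j) - (y (Suc j) - y j))))
         \<le> (\<Sum>j<m. 4 * (if x (Suc j) - x j \<le> 1 then 0 else x (Suc j) - x j) + 4 * (y (Suc j) - y j)\<^sup>2)"
    (is "norm ?L \<le> _")
proof -
  define G where "G j = exp (\<i> * of_real (u * (x j - x 0))) * exp (c * of_real (y m - y (Suc j)))" for j
  have Re_c: "Re c \<le> 0" by (simp add: c_def Re_exp)
  have norm_c: "norm c \<le> 2" unfolding c_def
    by (rule norm_triangle_le_diff) (simp add: norm_exp_i_times)
  have eq: "?L = (\<Sum>j<m. G j * ((exp (\<i> * of_real (u * (x (Suc j) - x j))) - 1 - c * of_real (x (Suc j) - x j))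
       - (exp (c * of_real (y (Suc j) - y j)) - 1 - c * of_real (y (Suc j) - y j))))"
    unfolding c_def
    by (subst telescoping_characteristic_sum[symmetric])
       (simp add: sum_subtractf[symmetric] G_def c_def algebra_simps)
  show ?thesis
    unfolding eq
  proof (rule sum_norm_le)
    fix j assume "j \<in> {..<m}"
    then have j: "j < m" by simp
    have "norm (exp (c * of_real (y (Suc j) - y j)) - 1 - c * of_real (y (Suc j) - y j))
          \<le> (norm (c * of_real (y (Suc j) - y j)))\<^sup>2"
      using y[of j "Suc j"] j Re_c
      by (intro norm_exp_sub_linear_le) (auto intro: mult_nonpos_nonneg)
    also have "\<dots> \<le> 2\<^sup>2 * (y (Suc j) - y j)\<^sup>2"
      unfolding norm_mult norm_of_real power_mult_distrib power2_abs
      using norm_c by (intro mult_right_mono power_mono) auto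
    finally have 1: "norm (exp (c * of_real (y (Suc j) - y j)) - 1 - c * of_real (y (Suc j) - y j))
          \<le> 4 * (y (Suc j) - y j)\<^sup>2" by simp
    define R where "R = (exp (\<i> * of_real (u * (x (Suc j) - x j))) - 1 - c * of_real (x (Suc j) - x j))
       - (exp (c * of_real (y (Suc j) - y j)) - 1 - c * of_real (y (Suc j) - y j))"
    have R: "norm R \<le> 4 * (if x (Suc j) - x j \<le> 1 then 0 else x (Suc j) - x j) + 4 * (y (Suc j) - y j)\<^sup>2"
      unfolding R_def
      by (rule norm_triangle_le_diff[OF add_mono[OF norm_exp_nat_step_le[OF x[OF j], of u, folded c_def] 1]])
    have "norm (G j) \<le> 1"
      using y[of "Suc j" m] j Re_c
      by (auto simp: G_def norm_mult norm_exp_i_times mult_nonpos_nonneg)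
    then have "norm (G j * R) \<le> norm R"
      using mult_right_mono[of "norm (G j)" 1 "norm R"] by (simp add: norm_mult)
    from order_trans[OF this R]
    show "norm (G j * ((exp (\<i> * of_real (u * (x (Suc j) - x j))) - 1 - c * of_real (x (Suc j) - x j))
       - (exp (c * of_real (y (Suc j) - y j)) - 1 - c * of_real (y (Suc j) - y j))))
       \<le> 4 * (if x (Suc j) - x j \<le> 1 then 0 else x (Suc j) - x j) + 4 * (y (Suc j) - y j)\<^sup>2"
      unfolding R_def .
  qed
qed

text \<open>The last conjunct says that all jumps are unit jumps, and that on bounded intervals their distances
  are bounded away from \<open>0\<close>.\<close>

definition simple_counting_path :: "(real \<Rightarrow> real) \<Rightarrow> bool" where
  "simple_counting_path f \<longleftrightarrow>
     f 0 = 0 \<and> mono_on {0..} f \<and> (\<forall>t\<ge>0. f t \<in> \<nat>) \<and>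
     (\<forall>t. \<exists>\<delta>>0. \<forall>a b. 0 \<le> a \<longrightarrow> a \<le> b \<longrightarrow> b \<le> t \<longrightarrow> b - a < \<delta> \<longrightarrow> f b - f a \<le> 1)"

definition compensator_path :: "(real \<Rightarrow> real) \<Rightarrow> bool" where
  "compensator_path a \<longleftrightarrow> a 0 = 0 \<and> mono_on {0..} a \<and> continuous_on {0..} a"

definition uniform_partition :: "real \<Rightarrow> real \<Rightarrow> nat \<Rightarrow> nat \<Rightarrow> real" where
  "uniform_partition r t m j = r + (t - r) * (real j / real m)"

lemma uniform_partition_mono:
  "r \<le> t \<Longrightarrow> i \<le> j \<Longrightarrow> uniform_partition r t m i \<le> uniform_partition r t m j"
  by (auto simp: uniform_partition_def intro!: mult_left_mono divide_right_mono)

lemma uniform_partition_0 [simp]: "uniform_partition r t m 0 = r"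
  by (simp add: uniform_partition_def)

lemma uniform_partition_last [simp]: "m > 0 \<Longrightarrow> uniform_partition r t m m = t"
  by (simp add: uniform_partition_def)

lemma uniform_partition_step:
  "uniform_partition r t m (Suc j) - uniform_partition r t m j = (t - r) / real m"
  by (simp add: uniform_partition_def algebra_simps add_divide_distrib)

text \<open>What is left of the telescoping sum of \<open>exp (\<i> u (f s - f r)) * exp (c (a t - a s))\<close>, from \<open>s = r\<close>
  to \<open>s = t\<close>, after its increments are linearised in those of \<open>f\<close> and \<open>a\<close>.\<close>

definition characteristic_remainder ::
    "real \<Rightarrow> real \<Rightarrow> real \<Rightarrow> nat \<Rightarrow> (real \<Rightarrow> real) \<Rightarrow> (real \<Rightarrow> real) \<Rightarrow> complex" where
  "characteristic_remainder u r t m f a =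
     (let p = uniform_partition r t m; c = exp (\<i> * of_real u) - 1 in
      exp (\<i> * of_real (u * (f t - f r))) - exp (c * of_real (a t - a r))
       - (\<Sum>j<m. exp (\<i> * of_real (u * (f (p j) - f r))) * exp (c * of_real (a t - a (p (Suc j)))) *
               c * of_real ((f (p (Suc j)) - f (p j)) - (a (p (Suc j)) - a (p j)))))"

lemma Nats_diff_real: "a \<in> \<nat> \<Longrightarrow> b \<in> \<nat> \<Longrightarrow> b \<le> a \<Longrightarrow> a - b \<in> (\<nat>::real set)"
  by (auto elim!: Nats_cases simp: of_nat_diff[symmetric] simp del: of_nat_diff)

context
  fixes f a :: "real \<Rightarrow> real" and r t u :: real
  assumes f: "simple_counting_path f" and a: "compensator_path a" and rt: "0 \<le> r" "r \<le> t"
begin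

lemma norm_characteristic_remainder_partition_le:
  fixes m :: nat
  assumes m: "m > 0"
  defines "p \<equiv> uniform_partition r t m"
  shows "norm (characteristic_remainder u r t m f a) \<le>
    (\<Sum>j<m. 4 * (if f (p (Suc j)) - f (p j) \<le> 1 then 0 else f (p (Suc j)) - f (p j))
           + 4 * (a (p (Suc j)) - a (p j))\<^sup>2)"
proof -
  have p: "0 \<le> p i" "p i \<le> p j" if "i \<le> j" for i j
    using uniform_partition_mono[OF rt(2) that, of m] uniform_partition_mono[OF rt(2), of 0 i m] rt
    by (auto simp: p_def)
  have fm: "f (p i) \<le> f (p j)" and am: "a (p i) \<le> a (p j)" if "i \<le> j" for i j
    using p[OF that] p[of j j] f a
    by (auto simp: simple_counting_path_def compensator_path_def intro: mono_onD)
  have "f (p (Suc j)) - f (p j) \<in> \<nat>" for j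
    using f p[of j j] p[of "Suc j" "Suc j"] fm[of j "Suc j"]
    by (intro Nats_diff_real) (auto simp: simple_counting_path_def)
  with norm_characteristic_remainder_le[of m "f \<circ> p" "a \<circ> p" u] am m show ?thesis
    by (simp add: p_def characteristic_remainder_def Let_def cong: if_cong)
qed

text \<open>A bound uniform in \<open>m\<close>, for later use as a dominating function. Both sums
  telescope, the squares after one factor \<open>a (p (Suc j)) - a (p j)\<close> has been estimated
  by \<open>a t\<close>.\<close>

lemma norm_characteristic_remainder_le_bound:
  assumes m: "m > 0"
  shows "norm (characteristic_remainder u r t m f a) \<le> 4 * f t + 4 * (a t)\<^sup>2"
proof -
  define p where "p = uniform_partition r t m"
  have p: "0 \<le> p i" "p i \<le> p j" if "i \<le> j" for i j
    using uniform_partition_mono[OF rt(2) that, of m] uniform_partition_mono[OF rt(2), of 0 i m] rt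
    by (auto simp: p_def)
  have fm: "f (p i) \<le> f (p j)" and am: "a (p i) \<le> a (p j)" if "i \<le> j" for i j
    using p[OF that] p[of j j] f a
    by (auto simp: simple_counting_path_def compensator_path_def intro: mono_onD)
  have pm: "p 0 = r" "p m = t" using m by (auto simp: p_def)
  have "0 \<le> f r" using f rt mono_onD[of "{0..}" f 0 r] by (auto simp: simple_counting_path_def)
  have "0 \<le> a r" using a rt mono_onD[of "{0..}" a 0 r] by (auto simp: compensator_path_def)
  have "a r \<le> a t" using am[of 0 m] pm by simp
  have "(\<Sum>j<m. 4 * (if f (p (Suc j)) - f (p j) \<le> 1 then 0 else f (p (Suc j)) - f (p j))
           + 4 * (a (p (Suc j)) - a (p j))\<^sup>2) \<le>
        (\<Sum>j<m. 4 * (f (p (Suc j)) - f (p j)) + 4 * (a t * (a (p (Suc j)) - a (p j))))"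
  proof (rule sum_mono, rule add_mono)
    fix j assume "j \<in> {..<m}"
    then have j: "j < m" by simp
    show "4 * (if f (p (Suc j)) - f (p j) \<le> 1 then 0 else f (p (Suc j)) - f (p j)) \<le> 4 * (f (p (Suc j)) - f (p j))"
      using fm[of j "Suc j"] by simp
    have "a (p (Suc j)) \<le> a t" using am[of "Suc j" m] j pm by simp
    moreover have "0 \<le> a (p j)" using am[of 0 j] pm \<open>0 \<le> a r\<close> by simp
    ultimately show "4 * (a (p (Suc j)) - a (p j))\<^sup>2 \<le> 4 * (a t * (a (p (Suc j)) - a (p j)))"
      using am[of j "Suc j"] unfolding power2_eq_square by (auto intro!: mult_right_mono)
  qed
  also have "\<dots> = 4 * (\<Sum>j<m. f (p (Suc j)) - f (p j)) + 4 * (a t * (\<Sum>j<m. a (p (Suc j)) - a (p j)))"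
    by (simp only: sum.distrib sum_distrib_left)
  also have "\<dots> = 4 * (f t - f r) + 4 * (a t * (a t - a r))"
    using sum_lessThan_telescope[of "\<lambda>j. f (p j)" m] sum_lessThan_telescope[of "\<lambda>j. a (p j)" m] pm
    by simp
  also have "\<dots> \<le> 4 * f t + 4 * (a t)\<^sup>2"
    using \<open>0 \<le> f r\<close> \<open>0 \<le> a r\<close> \<open>a r \<le> a t\<close> unfolding power2_eq_square
    by (intro add_mono mult_left_mono) auto
  finally show ?thesis
    using norm_characteristic_remainder_partition_le[OF m, folded p_def] by linarith
qed

text \<open>For small mesh no interval carries two jumps and the counting errors vanish altogether.
  Each square is at most the oscillation of \<open>a\<close> on the interval times the increment,
  and the increments add up to \<open>a t - a r\<close>.\<close>

lemma characteristic_remainder_tendsto_0: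
  "(\<lambda>m. characteristic_remainder u r t m f a) \<longlonglongrightarrow> 0"
proof (rule LIMSEQ_I)
  fix e :: real assume "e > 0"
  \<comment> \<open>The summand \<open>1\<close> keeps \<open>C\<close> positive when
    \<open>a\<close> is constant on \<open>[r, t]\<close> and makes the last estimate
    strict.\<close>
  define C where "C = 4 * (a t - a r) + 1"
  have art: "a r \<le> a t" using a rt by (auto simp: compensator_path_def intro: mono_onD)
  then have C: "C > 0" by (simp add: C_def)
  have "uniformly_continuous_on {r..t} a"
    using a rt by (intro compact_uniformly_continuous)
      (auto simp: compensator_path_def intro: continuous_on_subset)
  then obtain d1 where d1: "d1 > 0" "\<And>x x'. x \<in> {r..t} \<Longrightarrow> x' \<in> {r..t} \<Longrightarrow> dist x' x < d1 \<Longrightarrow> dist (a x') (a x) < e / C"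
    unfolding uniformly_continuous_on_def using \<open>e > 0\<close> C by (metis divide_pos_pos)
  obtain d2 where d2: "d2 > 0" "\<And>x x'. 0 \<le> x \<Longrightarrow> x \<le> x' \<Longrightarrow> x' \<le> t \<Longrightarrow> x' - x < d2 \<Longrightarrow> f x' - f x \<le> 1"
    using f unfolding simple_counting_path_def by metis
  obtain m0 :: nat where m0: "(t - r) / min d1 d2 < real m0" using reals_Archimedean2 by blast
  show "\<exists>no. \<forall>m\<ge>no. norm (characteristic_remainder u r t m f a - 0) < e"
  proof (intro exI allI impI)
    fix m assume "m \<ge> Suc m0"
    then have m: "m > 0" "(t - r) / min d1 d2 < real m" using m0 by linarith+
    define d where "d = min d1 d2"
    have "d > 0" using d1(1) d2(1) by (simp add: d_def)
    with m have "(t - r) / real m < d" by (simp add: d_def[symmetric] field_simps)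
    then have step: "(t - r) / real m < min d1 d2" by (simp add: d_def)
    define p where "p = uniform_partition r t m"
    have p: "0 \<le> p i" "p i \<le> p j" if "i \<le> j" for i j
      using uniform_partition_mono[OF rt(2) that, of m] uniform_partition_mono[OF rt(2), of 0 i m] rt
      by (auto simp: p_def)
    have am: "a (p i) \<le> a (p j)" if "i \<le> j" for i j
      using p[OF that] p[of j j] a
      by (auto simp: compensator_path_def intro: mono_onD)
    have pm: "p 0 = r" "p m = t" using m by (auto simp: p_def)
    have "(\<Sum>j<m. 4 * (if f (p (Suc j)) - f (p j) \<le> 1 then 0 else f (p (Suc j)) - f (p j))
           + 4 * (a (p (Suc j)) - a (p j))\<^sup>2) \<le>
        (\<Sum>j<m. (4 * (e / C)) * (a (p (Suc j)) - a (p j)))"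
    proof (rule sum_mono)
      fix j assume "j \<in> {..<m}"
      then have j: "j < m" by simp
      have pj: "r \<le> p j" "p j \<le> p (Suc j)" "p (Suc j) \<le> t"
        using p(2)[of 0 j] p(2)[of "Suc j" m] p(2)[of j "Suc j"] pm j by auto
      have st: "p (Suc j) - p j = (t - r) / real m" by (simp add: p_def uniform_partition_step)
      have "f (p (Suc j)) - f (p j) \<le> 1"
        using d2(2)[of "p j" "p (Suc j)"] pj rt st step by auto
      moreover have "dist (a (p (Suc j))) (a (p j)) < e / C"
        using pj st step by (intro d1(2)) (auto simp: dist_real_def)
      then have "a (p (Suc j)) - a (p j) \<le> e / C" by (simp add: dist_real_def)
      then have "(a (p (Suc j)) - a (p j))\<^sup>2 \<le> (e / C) * (a (p (Suc j)) - a (p j))"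
        using am[of j "Suc j"] unfolding power2_eq_square by (intro mult_right_mono) auto
      ultimately show "4 * (if f (p (Suc j)) - f (p j) \<le> 1 then 0 else f (p (Suc j)) - f (p j))
           + 4 * (a (p (Suc j)) - a (p j))\<^sup>2 \<le> (4 * (e / C)) * (a (p (Suc j)) - a (p j))"
        by simp
    qed
    also have "\<dots> = (4 * (e / C)) * (\<Sum>j<m. a (p (Suc j)) - a (p j))"
      by (simp only: sum_distrib_left)
    also have "\<dots> = e * (4 * (a t - a r) / C)"
      using sum_lessThan_telescope[of "\<lambda>j. a (p j)" m] pm by simp
    also have "\<dots> < e * 1"
      using \<open>e > 0\<close> C by (intro mult_strict_left_mono) (auto simp: C_def)
    finally show "norm (characteristic_remainder u r t m f a - 0) < e"
      using norm_characteristic_remainder_partition_le[OF m(1), folded p_def] by simp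
  qed
qed

end

section \<open>The mean of a mixed Poisson variable from its characteristic function\<close>

text \<open>The left side is the real part of \<open>1\<close> minus the characteristic function of
  a Poisson variable with mean \<open>w\<close>. Divided by \<open>u\<^sup>2 / 2\<close>, the right
  side is \<open>w + w\<^sup>2\<close>, the second moment of that variable.\<close>

lemma one_minus_exp_cos_le:
  fixes w u :: real
  assumes "0 \<le> w"
  shows "1 - exp ((cos u - 1) * w) * cos (w * sin u) \<le> u\<^sup>2 * (w + w\<^sup>2) / 2"
proof -
  have 1: "1 - cos v \<le> v\<^sup>2 / 2" for v :: real
  proof -
    have "(sin (v / 2))\<^sup>2 \<le> (v / 2)\<^sup>2"
      using abs_sin_x_le_abs_x[of "v / 2"] abs_le_square_iff by blast
    then show ?thesis
      using cos_double_sin[of "v / 2"] by (simp add: power_divide)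
  qed
  define x where "x = (1 - cos u) * w"
  have x: "0 \<le> x" "x \<le> u\<^sup>2 / 2 * w"
    using assms mult_right_mono[OF 1[of u] assms] by (auto simp: x_def)
  have "(sin u)\<^sup>2 \<le> u\<^sup>2"
    using abs_sin_x_le_abs_x[of u] abs_le_square_iff by blast
  then have "(w * sin u)\<^sup>2 \<le> (w * u)\<^sup>2"
    unfolding power_mult_distrib by (intro mult_left_mono) auto
  then have 2: "1 - cos (w * sin u) \<le> (w * u)\<^sup>2 / 2" using 1[of "w * sin u"] by linarith
  have "1 - exp (- x) * cos (w * sin u) = (1 - exp (- x)) + exp (- x) * (1 - cos (w * sin u))"
    by (simp add: algebra_simps)
  also have "\<dots> \<le> x + 1 * (1 - cos (w * sin u))"
    using exp_ge_add_one_self[of "- x"] x(1) by (intro add_mono mult_right_mono) auto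
  also have "\<dots> \<le> u\<^sup>2 / 2 * w + (w * u)\<^sup>2 / 2" using add_mono[OF x(2) 2] by (simp only: mult_1_left)
  also have "\<dots> = u\<^sup>2 * (w + w\<^sup>2) / 2" by (simp add: algebra_simps power2_eq_square)
  finally show ?thesis by (simp only: x_def mult_minus_left[symmetric] minus_diff_eq)
qed

lemma LIMSEQ_difference_quotient_0:
  fixes f :: "real \<Rightarrow> real"
  assumes "DERIV f 0 :> d" and "f 0 = 0"
  shows "(\<lambda>m. real (Suc m) * f (1 / real (Suc m))) \<longlonglongrightarrow> d"
proof -
  have "(\<lambda>h. f h / h) \<midarrow>0\<rightarrow> d"
    using assms by (simp add: DERIV_def)
  moreover have "filterlim (\<lambda>m. 1 / real (Suc m)) (at 0) sequentially"
    using LIMSEQ_inverse_real_of_nat by (simp add: filterlim_at inverse_eq_divide)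
  ultimately have "(\<lambda>m. f (1 / real (Suc m)) / (1 / real (Suc m))) \<longlonglongrightarrow> d"
    by (rule filterlim_compose)
  then show ?thesis by (simp add: mult.commute)
qed

lemma LIMSEQ_scaled_sin: "(\<lambda>m. real (Suc m) * sin (v / real (Suc m))) \<longlonglongrightarrow> v"
  using LIMSEQ_difference_quotient_0[of "\<lambda>h. sin (v * h)" v]
  by (simp add: DERIV_cong[OF DERIV_fun_sin[OF DERIV_cmult_Id]])

lemma LIMSEQ_scaled_cos: "(\<lambda>m. 2 * (real (Suc m))\<^sup>2 * (1 - cos (v / real (Suc m)))) \<longlonglongrightarrow> v\<^sup>2"
proof -
  have "(\<lambda>m. 4 * (real (Suc m) * sin (v / 2 / real (Suc m)))\<^sup>2) \<longlonglongrightarrow> 4 * (v / 2)\<^sup>2"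
    by (intro tendsto_intros LIMSEQ_scaled_sin)
  moreover have "1 - cos (v / real (Suc m)) = 2 * (sin (v / 2 / real (Suc m)))\<^sup>2" for m
    using cos_double_sin[of "v / 2 / real (Suc m)"] by (simp only: mult_2[of "v / 2 / _"] add_divide_distrib[symmetric] field_sum_of_halves) simp
  ultimately show ?thesis
    by (simp only: power_mult_distrib power_divide) (simp add: mult.assoc)
qed

text \<open>This is the imaginary part of the Poisson characteristic function at
  \<open>1 / Suc m\<close>, divided by that argument. The limit is the derivative at
  \<open>0\<close>, that is, the mean.\<close>

lemma LIMSEQ_scaled_exp_sin:
  "(\<lambda>m. real (Suc m) * (exp ((cos (1 / real (Suc m)) - 1) * w) * sin (w * sin (1 / real (Suc m))))) \<longlonglongrightarrow> w"
proof -
  have "DERIV (\<lambda>h. exp ((cos h - 1) * w) * sin (w * sin h)) 0 :> w"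
    by (auto intro!: derivative_eq_intros)
  from LIMSEQ_difference_quotient_0[OF this] show ?thesis by simp
qed

text \<open>No integrability of \<open>V\<close> is assumed: Fatou's lemma for \<open>2 (1 - cos (u V)) / u\<^sup>2\<close> bounds its second
  moment, and then \<open>sin (u V) / u\<close> is dominated.\<close>

lemma (in finite_measure) mixed_poisson_mean:
  fixes V W :: "'a \<Rightarrow> real" and K :: real
  assumes V [measurable]: "V \<in> borel_measurable M" and W [measurable]: "W \<in> borel_measurable M"
    and D [measurable]: "D \<in> sets M"
    and K: "AE \<omega> in M. \<omega> \<in> D \<longrightarrow> 0 \<le> W \<omega> \<and> W \<omega> \<le> K"
    and cos_eq: "\<And>u. (\<integral>\<omega>. indicator D \<omega> * cos (u * V \<omega>) \<partial>M)
                  = (\<integral>\<omega>. indicator D \<omega> * (exp ((cos u - 1) * W \<omega>) * cos (W \<omega> * sin u)) \<partial>M)"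
    and sin_eq: "\<And>u. (\<integral>\<omega>. indicator D \<omega> * sin (u * V \<omega>) \<partial>M)
                  = (\<integral>\<omega>. indicator D \<omega> * (exp ((cos u - 1) * W \<omega>) * sin (W \<omega> * sin u)) \<partial>M)"
  shows "integrable M (\<lambda>\<omega>. indicator D \<omega> * V \<omega>)"
    and "(\<integral>\<omega>. indicator D \<omega> * V \<omega> \<partial>M) = (\<integral>\<omega>. indicator D \<omega> * W \<omega> \<partial>M)"
proof -
  \<comment> \<open>\<open>C\<close> bounds the Poisson second moment \<open>W + W\<^sup>2\<close>
    on \<open>D\<close>; the absolute values make it nonnegative whatever the sign of
    \<open>K\<close>.\<close>
  define C where "C = \<bar>K\<bar> + \<bar>K\<bar>\<^sup>2"
  have cos_le: "(cos u - 1) * W \<omega> \<le> 0" if "0 \<le> W \<omega>" for u \<omega>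
    using that by (intro mult_nonpos_nonneg) auto
  have int_cos: "integrable M (\<lambda>\<omega>. indicator D \<omega> * (exp ((cos u - 1) * W \<omega>) * cos (W \<omega> * sin u)))" for u
  proof (rule integrable_const_bound[where B = 1])
    show "AE \<omega> in M. norm (indicator D \<omega> * (exp ((cos u - 1) * W \<omega>) * cos (W \<omega> * sin u))) \<le> 1"
      using K
    proof eventually_elim
      case (elim \<omega>)
      then show ?case
        using cos_le[of \<omega> u] by (auto simp: indicator_def abs_mult intro!: mult_le_one)
    qed
  qed simp
  have int_cosV: "integrable M (\<lambda>\<omega>. indicator D \<omega> * cos (u * V \<omega>))" for u
    by (rule integrable_const_bound[where B = 1]) (auto simp: indicator_def)
  have int_D: "integrable M (indicator D :: 'a \<Rightarrow> real)"
    by (rule integrable_const_bound[where B = 1]) (auto simp: indicator_def)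
  \<comment> \<open>Each Fatou term is a multiple of \<open>1 - cos (u V)\<close> with
    \<open>u = 1 / Suc m\<close>, hence integrable without any moment of \<open>V\<close>. Then
    \<open>cos_eq\<close> trades \<open>V\<close> for \<open>W\<close>, which is bounded on
    \<open>D\<close>.\<close>
  have second: "(\<integral>\<^sup>+\<omega>. ennreal (indicator D \<omega> * (2 * (real (Suc m))\<^sup>2 * (1 - cos (V \<omega> / real (Suc m))))) \<partial>M)
      \<le> ennreal (C * measure M (space M))" (is "?L m \<le> _") for m
  proof -
    define u where "u = 1 / real (Suc m)"
    have u: "u > 0" "2 * (real (Suc m))\<^sup>2 * (1 - cos (v / real (Suc m))) = 2 / u\<^sup>2 * (1 - cos (u * v))" for v
      by (simp_all add: u_def power_divide)
    have split: "indicator D \<omega> * (2 / u\<^sup>2 * (1 - cos (u * V \<omega>))) =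
        2 / u\<^sup>2 * (indicator D \<omega> - indicator D \<omega> * cos (u * V \<omega>))" for \<omega>
      by (simp add: indicator_def)
    have int_diff: "integrable M (\<lambda>\<omega>. indicator D \<omega> - indicator D \<omega> * cos (u * V \<omega>))"
      using int_D int_cosV by (rule Bochner_Integration.integrable_diff)
    have "?L m = ennreal (\<integral>\<omega>. indicator D \<omega> * (2 / u\<^sup>2 * (1 - cos (u * V \<omega>))) \<partial>M)"
      unfolding u(2)
    proof (rule nn_integral_eq_integral)
      show "integrable M (\<lambda>\<omega>. indicator D \<omega> * (2 / u\<^sup>2 * (1 - cos (u * V \<omega>))))"
        unfolding split by (intro integrable_mult_right int_diff)
    qed (auto simp: indicator_def)
    also have "(\<integral>\<omega>. indicator D \<omega> * (2 / u\<^sup>2 * (1 - cos (u * V \<omega>))) \<partial>M)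
        = 2 / u\<^sup>2 * ((\<integral>\<omega>. indicator D \<omega> \<partial>M) - (\<integral>\<omega>. indicator D \<omega> * cos (u * V \<omega>) \<partial>M))"
      unfolding split integral_mult_right_zero
      by (subst Bochner_Integration.integral_diff[OF int_D int_cosV]) (rule refl)
    also have "\<dots> = 2 / u\<^sup>2 * (\<integral>\<omega>. indicator D \<omega> - indicator D \<omega> * (exp ((cos u - 1) * W \<omega>) * cos (W \<omega> * sin u)) \<partial>M)"
      unfolding cos_eq by (subst Bochner_Integration.integral_diff[OF int_D int_cos]) (rule refl)
    also have "\<dots> \<le> 2 / u\<^sup>2 * (\<integral>\<omega>. u\<^sup>2 * C / 2 \<partial>M)"
    proof (intro mult_left_mono integral_mono_AE)
      show "AE \<omega> in M. indicator D \<omega> - indicator D \<omega> * (exp ((cos u - 1) * W \<omega>) * cos (W \<omega> * sin u)) \<le> u\<^sup>2 * C / 2"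
        using K
      proof eventually_elim
        case (elim \<omega>)
        show ?case
        proof (cases "\<omega> \<in> D")
          case True
          with elim have w: "0 \<le> W \<omega>" "W \<omega> \<le> \<bar>K\<bar>" by auto
          have "1 - exp ((cos u - 1) * W \<omega>) * cos (W \<omega> * sin u) \<le> u\<^sup>2 * (W \<omega> + (W \<omega>)\<^sup>2) / 2"
            by (rule one_minus_exp_cos_le[OF w(1)])
          also have "\<dots> \<le> u\<^sup>2 * C / 2" unfolding C_def
            using w by (intro divide_right_mono mult_left_mono add_mono power_mono) auto
          finally show ?thesis using True by simp
        qed (auto simp: C_def)
      qed
    qed (use int_D int_cos in simp_all)
    also have "\<dots> = C * measure M (space M)" by (simp add: u_def)
    finally show ?thesis by (simp add: ennreal_leI)
  qed
  have "(\<integral>\<^sup>+\<omega>. ennreal (indicator D \<omega> * (V \<omega>)\<^sup>2) \<partial>M) =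
     (\<integral>\<^sup>+\<omega>. liminf (\<lambda>m. ennreal (indicator D \<omega> * (2 * (real (Suc m))\<^sup>2 * (1 - cos (V \<omega> / real (Suc m)))))) \<partial>M)"
  proof (rule nn_integral_cong)
    fix \<omega>
    have "(\<lambda>m. ennreal (indicator D \<omega> * (2 * (real (Suc m))\<^sup>2 * (1 - cos (V \<omega> / real (Suc m))))))
       \<longlonglongrightarrow> ennreal (indicator D \<omega> * (V \<omega>)\<^sup>2)"
      by (intro tendsto_ennrealI tendsto_mult_left LIMSEQ_scaled_cos)
    then show "ennreal (indicator D \<omega> * (V \<omega>)\<^sup>2) =
       liminf (\<lambda>m. ennreal (indicator D \<omega> * (2 * (real (Suc m))\<^sup>2 * (1 - cos (V \<omega> / real (Suc m))))))"
      by (rule lim_imp_Liminf[symmetric, rotated]) simp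
  qed
  also have "\<dots> \<le> liminf (\<lambda>m. ?L m)"
    by (rule nn_integral_liminf) measurable
  also have "\<dots> \<le> liminf (\<lambda>m. ennreal (C * measure M (space M)))"
    by (intro Liminf_mono always_eventually allI second)
  also have "\<dots> < \<infinity>" by (simp add: Liminf_const)
  finally have "integrable M (\<lambda>\<omega>. indicator D \<omega> * (V \<omega>)\<^sup>2)"
    by (intro integrableI_nonneg) auto
  then have int2: "integrable M (\<lambda>\<omega>. indicator D \<omega> + indicator D \<omega> * (V \<omega>)\<^sup>2)"
    using int_D by simp
  have abs_le: "\<bar>v\<bar> \<le> 1 + v\<^sup>2" for v :: real
    using sum_squares_bound[of 1 "\<bar>v\<bar>"] by simp
  show int_V: "integrable M (\<lambda>\<omega>. indicator D \<omega> * V \<omega>)"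
    by (rule Bochner_Integration.integrable_bound[OF int2])
       (use abs_le in \<open>auto simp: indicator_def intro!: AE_I2\<close>)
  have lim1: "(\<lambda>m. \<integral>\<omega>. indicator D \<omega> * (real (Suc m) * sin (V \<omega> / real (Suc m))) \<partial>M)
      \<longlonglongrightarrow> (\<integral>\<omega>. indicator D \<omega> * V \<omega> \<partial>M)"
  proof (rule integral_dominated_convergence[where w = "\<lambda>\<omega>. \<bar>indicator D \<omega> * V \<omega>\<bar>"])
    show "AE \<omega> in M. norm (indicator D \<omega> * (real (Suc m) * sin (V \<omega> / real (Suc m)))) \<le> \<bar>indicator D \<omega> * V \<omega>\<bar>" for m
    proof (rule AE_I2)
      fix \<omega>
      have "real (Suc m) * \<bar>sin (V \<omega> / real (Suc m))\<bar> \<le> real (Suc m) * \<bar>V \<omega> / real (Suc m)\<bar>"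
        by (intro mult_left_mono abs_sin_x_le_abs_x) auto
      then show "norm (indicator D \<omega> * (real (Suc m) * sin (V \<omega> / real (Suc m)))) \<le> \<bar>indicator D \<omega> * V \<omega>\<bar>"
        by (auto simp: indicator_def abs_mult)
    qed
    show "AE \<omega> in M. (\<lambda>m. indicator D \<omega> * (real (Suc m) * sin (V \<omega> / real (Suc m)))) \<longlonglongrightarrow> indicator D \<omega> * V \<omega>"
      by (intro AE_I2 tendsto_mult_left LIMSEQ_scaled_sin)
  qed (use int_V in auto)
  have lim2: "(\<lambda>m. \<integral>\<omega>. indicator D \<omega> * (real (Suc m) *
        (exp ((cos (1 / real (Suc m)) - 1) * W \<omega>) * sin (W \<omega> * sin (1 / real (Suc m))))) \<partial>M)
      \<longlonglongrightarrow> (\<integral>\<omega>. indicator D \<omega> * W \<omega> \<partial>M)"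
  \<comment> \<open>The sine absorbs the factor \<open>Suc m\<close>: its argument is at most
    \<open>W / Suc m\<close> in absolute value, so on \<open>D\<close> the product stays below
    \<open>W\<close>.\<close>
  proof (rule integral_dominated_convergence[where w = "\<lambda>\<omega>. \<bar>K\<bar>"])
    show "AE \<omega> in M. norm (indicator D \<omega> * (real (Suc m) *
        (exp ((cos (1 / real (Suc m)) - 1) * W \<omega>) * sin (W \<omega> * sin (1 / real (Suc m)))))) \<le> \<bar>K\<bar>" for m
      using K
    proof eventually_elim
      case (elim \<omega>)
      show ?case
      proof (cases "\<omega> \<in> D")
        case True
        with elim have w: "0 \<le> W \<omega>" "W \<omega> \<le> \<bar>K\<bar>" by auto
        have "\<bar>sin (1 / real (Suc m))\<bar> \<le> 1 / real (Suc m)"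
          using abs_sin_x_le_abs_x[of "1 / real (Suc m)"] by simp
        then have "\<bar>sin (W \<omega> * sin (1 / real (Suc m)))\<bar> \<le> W \<omega> * (1 / real (Suc m))"
          using w by (intro order_trans[OF abs_sin_x_le_abs_x]) (simp only: abs_mult abs_of_nonneg mult_left_mono)
        then have "exp ((cos (1 / real (Suc m)) - 1) * W \<omega>) * \<bar>sin (W \<omega> * sin (1 / real (Suc m)))\<bar> \<le> 1 * (W \<omega> * (1 / real (Suc m)))"
          using cos_le[OF w(1)] by (intro mult_mono) auto
        then have "real (Suc m) * (exp ((cos (1 / real (Suc m)) - 1) * W \<omega>) * \<bar>sin (W \<omega> * sin (1 / real (Suc m)))\<bar>)
             \<le> real (Suc m) * (W \<omega> * (1 / real (Suc m)))"
          by (intro mult_left_mono) auto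
        also have "\<dots> \<le> \<bar>K\<bar>" using w by simp
        finally show ?thesis using True by (simp add: abs_mult)
      qed auto
    qed
    show "AE \<omega> in M. (\<lambda>m. indicator D \<omega> * (real (Suc m) *
        (exp ((cos (1 / real (Suc m)) - 1) * W \<omega>) * sin (W \<omega> * sin (1 / real (Suc m)))))) \<longlonglongrightarrow> indicator D \<omega> * W \<omega>"
      by (intro AE_I2 tendsto_mult_left LIMSEQ_scaled_exp_sin)
  qed auto
  have "(\<integral>\<omega>. indicator D \<omega> * (real (Suc m) * sin (V \<omega> / real (Suc m))) \<partial>M) =
     (\<integral>\<omega>. indicator D \<omega> * (real (Suc m) *
        (exp ((cos (1 / real (Suc m)) - 1) * W \<omega>) * sin (W \<omega> * sin (1 / real (Suc m))))) \<partial>M)" for m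
    using sin_eq[of "1 / real (Suc m)"]
    unfolding mult.left_commute[of _ "real (Suc m)"] integral_mult_right_zero by simp
  with lim1 lim2 show "(\<integral>\<omega>. indicator D \<omega> * V \<omega> \<partial>M) = (\<integral>\<omega>. indicator D \<omega> * W \<omega> \<partial>M)"
    by (simp only: LIMSEQ_unique)
qed

section \<open>Counting processes with an initially known compensator\<close>

lemma simple_counting_path_bounds:
  assumes "simple_counting_path f" "0 \<le> r" "r \<le> t"
  shows "0 \<le> f r" "f r \<le> f t"
  using assms mono_onD[of "{0..}" f 0 r] mono_onD[of "{0..}" f r t]
  by (auto simp: simple_counting_path_def)

lemma compensator_path_bounds:
  assumes "compensator_path a" "0 \<le> r" "r \<le> t"
  shows "0 \<le> a r" "a r \<le> a t"
  using assms mono_onD[of "{0..}" a 0 r] mono_onD[of "{0..}" a r t]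
  by (auto simp: compensator_path_def)

lemma cadlag_diff_continuous:
  assumes "cadlag f" and "continuous_on {0..} a"
  shows "cadlag (\<lambda>t. f t - a t)"
proof -
  have a: "(a \<longlongrightarrow> a t) (at t within {0..})" if "0 \<le> t" for t
    using assms(2) that by (simp add: continuous_on_def)
  have r: "(a \<longlongrightarrow> a t) (at_right t)" if "0 \<le> t" for t
    using a[OF that] by (rule tendsto_within_subset) (use that in auto)
  have l: "(a \<longlongrightarrow> a t) (at_left t)" if "0 < t" for t
  proof -
    have "at t within {0..} = at t" using that by (intro at_within_interior) auto
    then show ?thesis using a[of t] that by (simp add: filterlim_at_split)
  qed
  show ?thesis
    unfolding cadlag_def
  proof (intro conjI allI impI)
    fix t :: real assume "0 \<le> t"
    then show "((\<lambda>t. f t - a t) \<longlongrightarrow> f t - a t) (at_right t)"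
      using assms(1) r by (intro tendsto_diff) (auto simp: cadlag_def)
  next
    fix t :: real assume t: "0 < t"
    then obtain b where "(f \<longlongrightarrow> b) (at_left t)" using assms(1) by (auto simp: cadlag_def)
    from tendsto_diff[OF this l[OF t]] show "\<exists>b. ((\<lambda>t. f t - a t) \<longlongrightarrow> b) (at_left t)" by blast
  qed
qed

lemma enn2real_min_time:
  assumes "0 \<le> t"
  shows "0 \<le> enn2real (min (ennreal t) \<tau>)" "enn2real (min (ennreal t) \<tau>) \<le> t"
proof -
  have "enn2real (min (ennreal t) \<tau>) \<le> enn2real (ennreal t)"
    by (rule enn2real_mono) auto
  then show "enn2real (min (ennreal t) \<tau>) \<le> t" using assms by simp
qed simp

text \<open>The interface between the probabilistic argument and the concrete processes. The times
  have disappeared, and all that is left of the intensity is \<open>A\<close>, each value of which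
  is known at time \<open>0\<close>. Path properties are required only almost surely, since
  finiteness of the counts and local integrability both leave exceptional null sets.\<close>

locale counting_compensator = prob_space M for M :: "'a measure" +
  fixes F :: "real \<Rightarrow> 'a measure" and N A :: "real \<Rightarrow> 'a \<Rightarrow> real"
  assumes subalgebra_F: "\<And>t. 0 \<le> t \<Longrightarrow> subalgebra M (F t)"
    and mono_F: "\<And>s t. 0 \<le> s \<Longrightarrow> s \<le> t \<Longrightarrow> sets (F s) \<subseteq> sets (F t)"
    and N_adapted: "\<And>t. 0 \<le> t \<Longrightarrow> N t \<in> borel_measurable (F t)"
    and A_F0: "\<And>t. 0 \<le> t \<Longrightarrow> A t \<in> borel_measurable (F 0)"
    and N_path: "AE \<omega> in M. simple_counting_path (\<lambda>t. N t \<omega>)"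
    and N_cadlag: "AE \<omega> in M. cadlag (\<lambda>t. N t \<omega>)"
    and A_path: "AE \<omega> in M. compensator_path (\<lambda>t. A t \<omega>)"
begin

abbreviation Y :: "real \<Rightarrow> 'a \<Rightarrow> real" where "Y t \<omega> \<equiv> N t \<omega> - A t \<omega>"

text \<open>Restricting to events on which \<open>A t\<close> is bounded replaces the localization.\<close>

definition mean_compensated :: bool where
  "mean_compensated \<longleftrightarrow>
     (\<forall>r t K D. 0 \<le> r \<longrightarrow> r \<le> t \<longrightarrow> D \<in> sets (F r) \<longrightarrow> (AE \<omega> in M. \<omega> \<in> D \<longrightarrow> A t \<omega> \<le> K) \<longrightarrow>
        integrable M (\<lambda>\<omega>. indicator D \<omega> * N t \<omega>) \<and>
        (\<integral>\<omega>. indicator D \<omega> * (Y t \<omega> - Y r \<omega>) \<partial>M) = 0)"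

definition characteristic_identity :: bool where
  "characteristic_identity \<longleftrightarrow>
     (\<forall>u r t. 0 \<le> r \<longrightarrow> r \<le> t \<longrightarrow>
        (AE \<omega> in M. complex_cond_exp M (F r) (\<lambda>\<omega>. exp (\<i> * of_real (u * (N t \<omega> - N r \<omega>)))) \<omega>
           = exp ((exp (\<i> * of_real u) - 1) * of_real (A t \<omega> - A r \<omega>))))"

section \<open>Measurability, bounds and integrability\<close>

lemma space_F: "0 \<le> t \<Longrightarrow> space (F t) = space M"
  using subalgebra_F by (simp add: subalgebra_def)

lemma sets_F: "0 \<le> t \<Longrightarrow> D \<in> sets (F t) \<Longrightarrow> D \<in> sets M"
  using subalgebra_F by (auto simp: subalgebra_def)

lemma sigma_finite_subalgebra_F: "0 \<le> t \<Longrightarrow> sigma_finite_subalgebra M (F t)"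
  by (intro finite_measure_subalgebra_is_sigma_finite finite_measure_subalgebra.intro
        finite_measure_subalgebra_axioms.intro subalgebra_F finite_measure_axioms)

lemma measurable_F_mono:
  assumes "f \<in> borel_measurable (F s)" "0 \<le> s" "s \<le> t"
  shows "f \<in> borel_measurable (F t)"
proof (rule measurable_from_subalg[OF _ assms(1)])
  show "subalgebra (F t) (F s)"
    using assms mono_F[of s t] by (simp add: subalgebra_def space_F)
qed

lemma N_measurable_F: "0 \<le> s \<Longrightarrow> s \<le> t \<Longrightarrow> N s \<in> borel_measurable (F t)"
  using N_adapted measurable_F_mono by blast

lemma A_measurable_F: "0 \<le> s \<Longrightarrow> 0 \<le> t \<Longrightarrow> A s \<in> borel_measurable (F t)"
  using A_F0 measurable_F_mono by blast

lemma measurable_F_M: "f \<in> borel_measurable (F t) \<Longrightarrow> 0 \<le> t \<Longrightarrow> f \<in> borel_measurable M"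
  using measurable_from_subalg subalgebra_F by blast

lemma N_measurable [measurable]: "0 \<le> t \<Longrightarrow> N t \<in> borel_measurable M"
  using N_adapted measurable_F_M by blast

lemma A_measurable [measurable]: "0 \<le> t \<Longrightarrow> A t \<in> borel_measurable M"
  using A_F0 measurable_F_M by blast

lemma A_bounded_F0: "0 \<le> t \<Longrightarrow> {\<omega> \<in> space M. A t \<omega> \<le> K} \<in> sets (F 0)"
  using measurable_sets[OF A_F0, of t "{..K}"] by (simp add: space_F vimage_def Int_def conj_commute)

lemma N_bounds: "0 \<le> r \<Longrightarrow> r \<le> t \<Longrightarrow> AE \<omega> in M. 0 \<le> N r \<omega> \<and> N r \<omega> \<le> N t \<omega>"
  using N_path by eventually_elim (auto dest: simple_counting_path_bounds)

lemma A_bounds: "0 \<le> r \<Longrightarrow> r \<le> t \<Longrightarrow> AE \<omega> in M. 0 \<le> A r \<omega> \<and> A r \<omega> \<le> A t \<omega>"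
  using A_path by eventually_elim (auto dest: compensator_path_bounds)

lemma Y_0: "AE \<omega> in M. Y 0 \<omega> = 0"
  using N_path A_path by eventually_elim (simp add: simple_counting_path_def compensator_path_def)

lemma integrable_A_on:
  assumes "D \<in> sets M" "AE \<omega> in M. \<omega> \<in> D \<longrightarrow> A t \<omega> \<le> K" "0 \<le> s" "s \<le> t"
  shows "integrable M (\<lambda>\<omega>. indicator D \<omega> * A s \<omega>)"
proof (rule integrable_const_bound[where B = "\<bar>K\<bar>"])
  show "AE \<omega> in M. norm (indicator D \<omega> * A s \<omega>) \<le> \<bar>K\<bar>"
    using assms(2) A_bounds[OF assms(3,4)] by eventually_elim (auto simp: indicator_def)
qed (use assms in measurable)

lemma integrable_N_on:
  assumes "D \<in> sets M" "integrable M (\<lambda>\<omega>. indicator D \<omega> * N t \<omega>)" "0 \<le> s" "s \<le> t"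
  shows "integrable M (\<lambda>\<omega>. indicator D \<omega> * N s \<omega>)"
proof (rule Bochner_Integration.integrable_bound[OF assms(2)])
  show "AE \<omega> in M. norm (indicator D \<omega> * N s \<omega>) \<le> norm (indicator D \<omega> * N t \<omega>)"
    using N_bounds[OF assms(3,4)] by eventually_elim (auto simp: indicator_def)
qed (use assms in measurable)

lemma integrable_Y_on:
  assumes "D \<in> sets M" "AE \<omega> in M. \<omega> \<in> D \<longrightarrow> A t \<omega> \<le> K"
    "integrable M (\<lambda>\<omega>. indicator D \<omega> * N t \<omega>)" "0 \<le> s" "s \<le> t"
  shows "integrable M (\<lambda>\<omega>. indicator D \<omega> * Y s \<omega>)"
  unfolding right_diff_distrib
  by (rule Bochner_Integration.integrable_diff[OF
        integrable_N_on[OF assms(1,3-5)] integrable_A_on[OF assms(1,2,4,5)]])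

lemma integrable_indicator_subset:
  fixes f :: "'a \<Rightarrow> real"
  assumes "integrable M (\<lambda>\<omega>. indicator B \<omega> * f \<omega>)" "D \<in> sets M" "f \<in> borel_measurable M"
    "AE \<omega> in M. \<omega> \<in> D \<longrightarrow> \<omega> \<in> B"
  shows "integrable M (\<lambda>\<omega>. indicator D \<omega> * f \<omega>)"
proof (rule Bochner_Integration.integrable_bound[OF assms(1)])
  show "AE \<omega> in M. norm (indicator D \<omega> * f \<omega>) \<le> norm (indicator B \<omega> * f \<omega>)"
    using assms(4) by eventually_elim (auto simp: indicator_def)
qed (use assms in measurable)

section \<open>From the characteristic identity to the means\<close>

lemma characteristic_identity_integrals:
  assumes "characteristic_identity" "0 \<le> r" "r \<le> t" and D: "D \<in> sets (F r)"
  shows "(\<integral>\<omega>. indicator D \<omega> * cos (u * (N t \<omega> - N r \<omega>)) \<partial>M)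
      = (\<integral>\<omega>. indicator D \<omega> * (exp ((cos u - 1) * (A t \<omega> - A r \<omega>)) * cos ((A t \<omega> - A r \<omega>) * sin u)) \<partial>M)" (is ?cos)
    and "(\<integral>\<omega>. indicator D \<omega> * sin (u * (N t \<omega> - N r \<omega>)) \<partial>M)
      = (\<integral>\<omega>. indicator D \<omega> * (exp ((cos u - 1) * (A t \<omega> - A r \<omega>)) * sin ((A t \<omega> - A r \<omega>) * sin u)) \<partial>M)" (is ?sin)
proof -
  interpret Fr: sigma_finite_subalgebra M "F r" by (rule sigma_finite_subalgebra_F[OF assms(2)])
  have [measurable]: "D \<in> sets M" using D assms by (auto intro: sets_F)
  note [measurable] = N_measurable[of r] N_measurable[of t] A_measurable[of r] A_measurable[of t]
  have [simp]: "0 \<le> t" "0 \<le> r" using assms by auto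
  define c where "c = exp (\<i> * of_real u) - 1"
  have c: "Re c = cos u - 1" "Im c = sin u" by (simp_all add: c_def Re_exp Im_exp)
  have "AE \<omega> in M. complex_cond_exp M (F r) (\<lambda>\<omega>. exp (\<i> * of_real (u * (N t \<omega> - N r \<omega>)))) \<omega>
           = exp (c * of_real (A t \<omega> - A r \<omega>))"
    using assms(1-3) unfolding characteristic_identity_def c_def by blast
  then have AE_eq: "AE \<omega> in M. real_cond_exp M (F r) (\<lambda>\<omega>. cos (u * (N t \<omega> - N r \<omega>))) \<omega> =
        exp ((cos u - 1) * (A t \<omega> - A r \<omega>)) * cos ((A t \<omega> - A r \<omega>) * sin u) \<and>
      real_cond_exp M (F r) (\<lambda>\<omega>. sin (u * (N t \<omega> - N r \<omega>))) \<omega> =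
        exp ((cos u - 1) * (A t \<omega> - A r \<omega>)) * sin ((A t \<omega> - A r \<omega>) * sin u)"
    by eventually_elim
       (auto simp: complex_cond_exp_def complex_eq_iff Re_exp Im_exp c mult.commute[of "sin u"] simp flip: of_real_diff of_real_mult)
  have "(\<integral>\<omega>. indicator D \<omega> * cos (u * (N t \<omega> - N r \<omega>)) \<partial>M)
      = (\<integral>\<omega>. indicator D \<omega> * real_cond_exp M (F r) (\<lambda>\<omega>. cos (u * (N t \<omega> - N r \<omega>))) \<omega> \<partial>M)"
    using Fr.real_cond_exp_intA[OF _ D, of "\<lambda>\<omega>. cos (u * (N t \<omega> - N r \<omega>))"]
    by (simp add: set_lebesgue_integral_def integrable_const_bound[where B = 1])
  also have "\<dots> = (\<integral>\<omega>. indicator D \<omega> * (exp ((cos u - 1) * (A t \<omega> - A r \<omega>)) * cos ((A t \<omega> - A r \<omega>) * sin u)) \<partial>M)"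
    using AE_eq by (intro integral_cong_AE) (auto intro: measurable_F_M)
  finally show ?cos .
  have "(\<integral>\<omega>. indicator D \<omega> * sin (u * (N t \<omega> - N r \<omega>)) \<partial>M)
      = (\<integral>\<omega>. indicator D \<omega> * real_cond_exp M (F r) (\<lambda>\<omega>. sin (u * (N t \<omega> - N r \<omega>))) \<omega> \<partial>M)"
    using Fr.real_cond_exp_intA[OF _ D, of "\<lambda>\<omega>. sin (u * (N t \<omega> - N r \<omega>))"]
    by (simp add: set_lebesgue_integral_def integrable_const_bound[where B = 1])
  also have "\<dots> = (\<integral>\<omega>. indicator D \<omega> * (exp ((cos u - 1) * (A t \<omega> - A r \<omega>)) * sin ((A t \<omega> - A r \<omega>) * sin u)) \<partial>M)"
    using AE_eq by (intro integral_cong_AE) (auto intro: measurable_F_M)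
  finally show ?sin .
qed

lemma characteristic_identity_imp_mean_compensated:
  assumes ci: "characteristic_identity"
  shows "mean_compensated"
  unfolding mean_compensated_def
proof (intro allI impI)
  fix r t K D
  assume rt: "0 \<le> r" "r \<le> t" and D: "D \<in> sets (F r)" and K: "AE \<omega> in M. \<omega> \<in> D \<longrightarrow> A t \<omega> \<le> K"
  then have t: "0 \<le> t" by simp
  note [measurable] = N_measurable[of r] N_measurable[of t] A_measurable[of r] A_measurable[of t]
  have DM [measurable]: "D \<in> sets M" using D rt by (auto intro: sets_F)
  define B where "B = {\<omega> \<in> space M. A t \<omega> \<le> K}"
  have B: "B \<in> sets (F 0)" unfolding B_def using t by (rule A_bounded_F0)
  \<comment> \<open>From time \<open>r\<close> one would only get integrability of
    \<open>N t - N r\<close>. Starting at \<open>0\<close> gives that of \<open>N t\<close> itself,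
    but requires an event of \<open>F 0\<close>, and so \<open>B\<close> in place of
    \<open>D\<close>.\<close>
  have "integrable M (\<lambda>\<omega>. indicator B \<omega> * (N t \<omega> - N 0 \<omega>))"
  proof (rule mixed_poisson_mean(1)[where W = "\<lambda>\<omega>. A t \<omega> - A 0 \<omega>" and K = K])
    show "AE \<omega> in M. \<omega> \<in> B \<longrightarrow> 0 \<le> A t \<omega> - A 0 \<omega> \<and> A t \<omega> - A 0 \<omega> \<le> K"
      using A_bounds[OF order_refl t] by eventually_elim (auto simp: B_def)
    show "B \<in> sets M" using B by (rule sets_F[rotated]) simp
  qed (use t N_measurable[of 0] A_measurable[of 0] in \<open>auto intro!: characteristic_identity_integrals[OF ci _ _ B]\<close>)
  moreover have "AE \<omega> in M. indicator B \<omega> * (N t \<omega> - N 0 \<omega>) = indicator B \<omega> * N t \<omega>"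
    using N_path by eventually_elim (simp add: simple_counting_path_def)
  ultimately have "integrable M (\<lambda>\<omega>. indicator B \<omega> * N t \<omega>)"
    using B sets_F[of 0 B] t N_measurable[of 0] by (subst integrable_cong_AE[symmetric]) auto
  then have int_N: "integrable M (\<lambda>\<omega>. indicator D \<omega> * N t \<omega>)"
    by (rule integrable_indicator_subset) (use K DM t sets.sets_into_space[OF DM] in \<open>auto simp: B_def\<close>)
  have int: "integrable M (\<lambda>\<omega>. indicator D \<omega> * (N t \<omega> - N r \<omega>))" "integrable M (\<lambda>\<omega>. indicator D \<omega> * (A t \<omega> - A r \<omega>))"
    unfolding right_diff_distrib
    using integrable_N_on[OF DM int_N] integrable_A_on[OF DM K] rt by auto
  have "(\<integral>\<omega>. indicator D \<omega> * (N t \<omega> - N r \<omega>) \<partial>M) = (\<integral>\<omega>. indicator D \<omega> * (A t \<omega> - A r \<omega>) \<partial>M)"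
  proof (rule mixed_poisson_mean(2)[where K = K])
    show "AE \<omega> in M. \<omega> \<in> D \<longrightarrow> 0 \<le> A t \<omega> - A r \<omega> \<and> A t \<omega> - A r \<omega> \<le> K"
      using A_bounds[OF rt] K by eventually_elim auto
  qed (use rt in \<open>auto intro!: characteristic_identity_integrals[OF ci _ _ D]\<close>)
  moreover have "indicator D \<omega> * (Y t \<omega> - Y r \<omega>) =
      indicator D \<omega> * (N t \<omega> - N r \<omega>) - indicator D \<omega> * (A t \<omega> - A r \<omega>)" for \<omega>
    by (simp add: algebra_simps)
  ultimately have "(\<integral>\<omega>. indicator D \<omega> * (Y t \<omega> - Y r \<omega>) \<partial>M) = 0"
    using int by simp
  with int_N show "integrable M (\<lambda>\<omega>. indicator D \<omega> * N t \<omega>) \<and>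
        (\<integral>\<omega>. indicator D \<omega> * (Y t \<omega> - Y r \<omega>) \<partial>M) = 0" by blast
qed

section \<open>From the means to the characteristic identity\<close>

lemma mean_compensated_weighted:
  fixes G :: "'a \<Rightarrow> complex"
  assumes mc: "mean_compensated" and rt: "0 \<le> r" "r \<le> t" and D: "D \<in> sets (F r)"
    and K: "AE \<omega> in M. \<omega> \<in> D \<longrightarrow> A t \<omega> \<le> K"
    and G: "G \<in> borel_measurable (F r)" and G_le: "AE \<omega> in M. norm (G \<omega>) \<le> 1"
  shows "integrable M (\<lambda>\<omega>. G \<omega> * of_real (indicator D \<omega> * (Y t \<omega> - Y r \<omega>)))"
    and "(\<integral>\<omega>. G \<omega> * of_real (indicator D \<omega> * (Y t \<omega> - Y r \<omega>)) \<partial>M) = 0"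
proof -
  interpret Fr: sigma_finite_subalgebra M "F r" by (rule sigma_finite_subalgebra_F[OF rt(1)])
  have t: "0 \<le> t" using rt by simp
  note [measurable] = N_measurable[OF rt(1)] N_measurable[OF t] A_measurable[OF rt(1)] A_measurable[OF t]
  have DM [measurable]: "D \<in> sets M" using D rt by (auto intro: sets_F)
  have GM [measurable]: "G \<in> borel_measurable M" using measurable_from_subalg[OF subalgebra_F[OF rt(1)] G] .
  define H where "H = (\<lambda>\<omega>. indicator D \<omega> * (Y t \<omega> - Y r \<omega>))"
  have int_N: "integrable M (\<lambda>\<omega>. indicator D \<omega> * N t \<omega>)"
    using mc D K rt unfolding mean_compensated_def by blast
  have H_int: "integrable M H"
    unfolding H_def right_diff_distrib[of _ "Y t _"]
    by (rule Bochner_Integration.integrable_diff; rule integrable_Y_on[OF DM K int_N]; use rt in simp)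
  then have HM [measurable]: "H \<in> borel_measurable M" by simp
  \<comment> \<open>For \<open>E\<close> in \<open>F r\<close> the event \<open>E \<inter> D\<close>
    inherits the bound on \<open>A t\<close>, so the vanishing means determine the conditional
    expectation. Weights from \<open>F r\<close> can then be pulled out of it.\<close>
  have zero: "AE \<omega> in M. real_cond_exp M (F r) H \<omega> = 0"
  proof (rule Fr.real_cond_exp_charact)
    fix E assume E: "E \<in> sets (F r)"
    have "(\<integral>\<omega>. indicator (E \<inter> D) \<omega> * (Y t \<omega> - Y r \<omega>) \<partial>M) = 0"
      using mc rt K sets.Int[OF E D] unfolding mean_compensated_def
      by (auto elim!: allE impE elim: eventually_mono)
    then show "(\<integral>\<omega>\<in>E. H \<omega> \<partial>M) = (\<integral>\<omega>\<in>E. 0 \<partial>M)"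
      by (simp add: set_lebesgue_integral_def H_def indicator_inter_arith mult.assoc)
  qed (use H_int in auto)
  have real0: "(\<integral>\<omega>. g \<omega> * H \<omega> \<partial>M) = 0"
    if g: "g \<in> borel_measurable (F r)" and gH: "integrable M (\<lambda>\<omega>. g \<omega> * H \<omega>)" for g :: "'a \<Rightarrow> real"
  proof -
    have [measurable]: "g \<in> borel_measurable M" using g rt(1) by (rule measurable_F_M)
    have "(\<integral>\<omega>. g \<omega> * H \<omega> \<partial>M) = (\<integral>\<omega>. g \<omega> * real_cond_exp M (F r) H \<omega> \<partial>M)"
      using Fr.real_cond_exp_intg(2)[OF gH g] by simp
    also have "\<dots> = (\<integral>\<omega>. 0 \<partial>M)"
      using zero by (intro integral_cong_AE) auto
    finally show ?thesis by simp
  qed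
  show int: "integrable M (\<lambda>\<omega>. G \<omega> * of_real (indicator D \<omega> * (Y t \<omega> - Y r \<omega>)))"
    unfolding fun_cong[OF H_def, symmetric]
  proof (rule Bochner_Integration.integrable_bound[OF H_int])
    show "AE \<omega> in M. norm (G \<omega> * of_real (H \<omega>)) \<le> norm (H \<omega>)"
      using G_le by eventually_elim (auto simp: norm_mult intro: mult_left_le_one_le)
  qed measurable
  have "Re (G \<omega> * of_real (H \<omega>)) = Re (G \<omega>) * H \<omega>" "Im (G \<omega> * of_real (H \<omega>)) = Im (G \<omega>) * H \<omega>" for \<omega>
    by simp_all
  then have "Re (\<integral>\<omega>. G \<omega> * of_real (H \<omega>) \<partial>M) = 0" "Im (\<integral>\<omega>. G \<omega> * of_real (H \<omega>) \<partial>M) = 0"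
    using real0[of "\<lambda>\<omega>. Re (G \<omega>)"] real0[of "\<lambda>\<omega>. Im (G \<omega>)"] G
      integrable_Re[OF int[folded fun_cong[OF H_def]]] integrable_Im[OF int[folded fun_cong[OF H_def]]]
      integral_Re[OF int[folded fun_cong[OF H_def]]] integral_Im[OF int[folded fun_cong[OF H_def]]]
    by simp_all
  then show "(\<integral>\<omega>. G \<omega> * of_real (indicator D \<omega> * (Y t \<omega> - Y r \<omega>)) \<partial>M) = 0"
    by (simp add: complex_eq_iff H_def)
qed

lemma norm_compensator_characteristic_le:
  assumes "0 \<le> s" "s \<le> t"
  shows "AE \<omega> in M. norm (exp ((exp (\<i> * of_real u) - 1) * of_real (A t \<omega> - A s \<omega>))) \<le> 1"
  using A_bounds[OF assms] by eventually_elim (auto simp: Re_exp intro!: mult_nonpos_nonneg)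

text \<open>The linear terms have mean zero for every partition, so the mean in question equals that
  of the remainder for every positive \<open>m\<close>. It vanishes because the remainder tends to
  \<open>0\<close> below a dominating function that the bound on \<open>A t\<close> makes
  integrable.\<close>

lemma mean_compensated_characteristic_bounded:
  fixes u :: real
  assumes mc: "mean_compensated" and rt: "0 \<le> r" "r \<le> t" and D: "D \<in> sets (F r)"
    and K: "AE \<omega> in M. \<omega> \<in> D \<longrightarrow> A t \<omega> \<le> K"
  shows "(\<integral>\<omega>. of_real (indicator D \<omega>) * (exp (\<i> * of_real (u * (N t \<omega> - N r \<omega>)))
            - exp ((exp (\<i> * of_real u) - 1) * of_real (A t \<omega> - A r \<omega>))) \<partial>M) = (0 :: complex)"
    (is "(\<integral>\<omega>. ?Z \<omega> \<partial>M) = 0")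
proof -
  define c where "c = exp (\<i> * of_real u) - 1"
  have t: "0 \<le> t" using rt by simp
  note [measurable] = N_measurable[OF rt(1)] N_measurable[OF t] A_measurable[OF rt(1)] A_measurable[OF t]
  have DM [measurable]: "D \<in> sets M" using D rt by (auto intro: sets_F)
  define Q where "Q m \<omega> = of_real (indicator D \<omega>) *
      characteristic_remainder u r t m (\<lambda>s. N s \<omega>) (\<lambda>s. A s \<omega>)" for m \<omega>
  have Z_int: "integrable M ?Z"
  proof (rule integrable_const_bound[where B = 2])
    show "AE \<omega> in M. norm (?Z \<omega>) \<le> 2"
      using norm_compensator_characteristic_le[OF rt, of u]
    proof eventually_elim
      case (elim \<omega>)
      have "norm (exp (\<i> * of_real (u * (N t \<omega> - N r \<omega>)))
            - exp ((exp (\<i> * of_real u) - 1) * of_real (A t \<omega> - A r \<omega>))) \<le> 1 + 1"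
        using elim by (intro norm_triangle_le_diff add_mono) (simp_all only: norm_exp_i_times)
      then show ?case by (auto simp: norm_mult indicator_def)
    qed
  qed measurable
  have Q: "integrable M (Q m)" "(\<integral>\<omega>. Q m \<omega> \<partial>M) = (\<integral>\<omega>. ?Z \<omega> \<partial>M)" if m: "m > 0" for m
  proof -
    define p where "p = uniform_partition r t m"
    have p: "r \<le> p j" "p j \<le> p (Suc j)" "0 \<le> p j" for j
      using uniform_partition_mono[OF rt(2), of 0 j m] uniform_partition_mono[OF rt(2), of j "Suc j" m] rt
      by (auto simp: p_def)
    have pt: "p j \<le> t" if "j \<le> m" for j
      using uniform_partition_mono[OF rt(2) that, of m] m by (simp add: p_def)
    define G where "G j \<omega> = exp (\<i> * of_real (u * (N (p j) \<omega> - N r \<omega>))) *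
        exp (c * of_real (A t \<omega> - A (p (Suc j)) \<omega>))" for j \<omega>
    define H where "H j \<omega> = G j \<omega> * of_real (indicator D \<omega> * (Y (p (Suc j)) \<omega> - Y (p j) \<omega>))" for j \<omega>
    have H: "integrable M (H j)" "(\<integral>\<omega>. H j \<omega> \<partial>M) = 0" if j: "j < m" for j
    proof -
      have Dj: "D \<in> sets (F (p j))" using D mono_F[OF rt(1) p(1)] by auto
      have Kj: "AE \<omega> in M. \<omega> \<in> D \<longrightarrow> A (p (Suc j)) \<omega> \<le> K"
        using K A_bounds[OF p(3) pt, of "Suc j"] j by (auto elim: eventually_elim2)
      \<comment> \<open>The weight involves \<open>A t\<close> and \<open>A (p (Suc j))\<close>,
        which look beyond \<open>p j\<close>. It is \<open>F (p j)\<close>-measurable all the same,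
        because every \<open>A s\<close> is \<open>F 0\<close>-measurable.\<close>
      have Gm: "G j \<in> borel_measurable (F (p j))"
      proof -
        note [measurable] = N_measurable_F[OF p(3) order_refl, of j] N_measurable_F[OF rt(1) p(1), of j]
          A_measurable_F[OF t p(3), of j] A_measurable_F[OF p(3) p(3), of "Suc j" j]
        show ?thesis unfolding G_def by measurable
      qed
      have Gle: "AE \<omega> in M. norm (G j \<omega>) \<le> 1"
        using norm_compensator_characteristic_le[OF p(3) pt, of "Suc j" u] j unfolding G_def norm_mult c_def
        by (auto simp only: norm_exp_i_times mult_1_left Suc_le_eq)
      show "integrable M (H j)" "(\<integral>\<omega>. H j \<omega> \<partial>M) = 0"
        unfolding H_def
        by (rule mean_compensated_weighted[OF mc p(3) p(2) Dj Kj Gm Gle])+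
    qed
    have Q_eq: "Q m = (\<lambda>\<omega>. ?Z \<omega> - (\<Sum>j<m. c * H j \<omega>))"
    proof (rule ext)
      fix \<omega>
      have d: "(N s \<omega> - N s' \<omega>) - (A s \<omega> - A s' \<omega>) = Y s \<omega> - Y s' \<omega>" for s s' by simp
      have "of_real (indicator D \<omega>) * (\<Sum>j<m. exp (\<i> * of_real (u * (N (p j) \<omega> - N r \<omega>))) *
              exp (c * of_real (A t \<omega> - A (p (Suc j)) \<omega>)) * c *
              of_real ((N (p (Suc j)) \<omega> - N (p j) \<omega>) - (A (p (Suc j)) \<omega> - A (p j) \<omega>)))
          = (\<Sum>j<m. c * H j \<omega>)"
        unfolding sum_distrib_left d H_def G_def of_real_mult by (rule sum.cong) (simp_all only: mult_ac)
      then show "Q m \<omega> = ?Z \<omega> - (\<Sum>j<m. c * H j \<omega>)"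
        unfolding Q_def characteristic_remainder_def Let_def p_def[symmetric] c_def[symmetric]
        by (simp only: right_diff_distrib[of "of_real (indicator D \<omega>)" "_ - _"])
    qed
    have S: "integrable M (\<lambda>\<omega>. \<Sum>j<m. c * H j \<omega>)"
      using H by (intro Bochner_Integration.integrable_sum integrable_mult_right) auto
    show "integrable M (Q m)" unfolding Q_eq using Z_int S by (rule Bochner_Integration.integrable_diff)
    have "(\<integral>\<omega>. (\<Sum>j<m. c * H j \<omega>) \<partial>M) = 0"
      using H by (subst Bochner_Integration.integral_sum) auto
    then show "(\<integral>\<omega>. Q m \<omega> \<partial>M) = (\<integral>\<omega>. ?Z \<omega> \<partial>M)"
      unfolding Q_eq by (subst Bochner_Integration.integral_diff[OF Z_int S]) simp
  qed
  have int_N: "integrable M (\<lambda>\<omega>. indicator D \<omega> * N t \<omega>)"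
    using mc D K rt unfolding mean_compensated_def by blast
  \<comment> \<open>A partition needs at least one interval, hence \<open>Suc m\<close>.\<close>
  have "(\<lambda>m. \<integral>\<omega>. Q (Suc m) \<omega> \<partial>M) \<longlonglongrightarrow> (\<integral>\<omega>. 0 \<partial>M)"
  proof (rule integral_dominated_convergence[where w = "\<lambda>\<omega>. 4 * (indicator D \<omega> * N t \<omega>) + 4 * K\<^sup>2"])
    show "Q (Suc m) \<in> borel_measurable M" for m using Q(1)[of "Suc m"] by simp
    show "integrable M (\<lambda>\<omega>. 4 * (indicator D \<omega> * N t \<omega>) + 4 * K\<^sup>2)" using int_N by simp
    show "AE \<omega> in M. (\<lambda>m. Q (Suc m) \<omega>) \<longlonglongrightarrow> 0"
      using N_path A_path
    proof eventually_elim
      case (elim \<omega>)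
      have "(\<lambda>m. characteristic_remainder u r t (Suc m) (\<lambda>s. N s \<omega>) (\<lambda>s. A s \<omega>)) \<longlonglongrightarrow> 0"
        using characteristic_remainder_tendsto_0[OF elim rt] by (rule LIMSEQ_Suc)
      then show ?case unfolding Q_def by (rule tendsto_mult_right_zero)
    qed
    show "AE \<omega> in M. norm (Q (Suc m) \<omega>) \<le> 4 * (indicator D \<omega> * N t \<omega>) + 4 * K\<^sup>2" for m
      using N_path A_path K
    proof eventually_elim
      case (elim \<omega>)
      show ?case
      proof (cases "\<omega> \<in> D")
        case True
        have "(A t \<omega>)\<^sup>2 \<le> K\<^sup>2"
          using elim True compensator_path_bounds(1)[OF elim(2) t order_refl] by (intro power_mono) auto
        then show ?thesis
          using norm_characteristic_remainder_le_bound[OF elim(1,2) rt, of "Suc m" u] True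
          by (simp add: Q_def)
      qed (simp add: Q_def)
    qed
  qed simp
  then show ?thesis using Q(2) by (simp add: LIMSEQ_const_iff)
qed

text \<open>Removes the bound on \<open>A t\<close>: the integrand has norm at most
  \<open>2\<close>, so dominated convergence along the events \<open>A t \<le> k\<close> applies
  even if \<open>N t\<close> is not integrable.\<close>

lemma mean_compensated_characteristic:
  fixes u :: real
  assumes mc: "mean_compensated" and rt: "0 \<le> r" "r \<le> t" and D: "D \<in> sets (F r)"
  defines "Z \<equiv> (\<lambda>\<omega>. exp (\<i> * of_real (u * (N t \<omega> - N r \<omega>)))
            - exp ((exp (\<i> * of_real u) - 1) * of_real (A t \<omega> - A r \<omega>)))"
  shows "integrable M (\<lambda>\<omega>. of_real (indicator D \<omega>) * Z \<omega>)"
    and "(\<integral>\<omega>. of_real (indicator D \<omega>) * Z \<omega> \<partial>M) = 0"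
proof -
  have t: "0 \<le> t" using rt by simp
  note [measurable] = N_measurable[OF rt(1)] N_measurable[OF t] A_measurable[OF rt(1)] A_measurable[OF t]
  have DM [measurable]: "D \<in> sets M" using D rt by (auto intro: sets_F)
  have Z_le: "AE \<omega> in M. norm (of_real (indicator E \<omega>) * Z \<omega>) \<le> 2" for E
    using norm_compensator_characteristic_le[OF rt, of u]
  proof eventually_elim
    case (elim \<omega>)
    have "norm (Z \<omega>) \<le> 1 + 1"
      unfolding Z_def using elim by (intro norm_triangle_le_diff add_mono) (simp_all only: norm_exp_i_times)
    then show ?case by (auto simp: norm_mult indicator_def)
  qed
  have [measurable]: "Z \<in> borel_measurable M" unfolding Z_def by measurable
  show "integrable M (\<lambda>\<omega>. of_real (indicator D \<omega>) * Z \<omega>)"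
    using Z_le by (rule integrable_const_bound) measurable
  define E where "E k = D \<inter> {\<omega> \<in> space M. A t \<omega> \<le> real k}" for k :: nat
  have E: "E k \<in> sets (F r)" for k
    unfolding E_def using A_bounded_F0[OF t, of "real k"] mono_F[of 0 r] rt D by auto
  have EM [measurable]: "E k \<in> sets M" for k using E sets_F rt by blast
  have "(\<lambda>k. \<integral>\<omega>. of_real (indicator (E k) \<omega>) * Z \<omega> \<partial>M) \<longlonglongrightarrow> (\<integral>\<omega>. of_real (indicator D \<omega>) * Z \<omega> \<partial>M)"
  proof (rule integral_dominated_convergence[where w = "\<lambda>_. 2"])
    show "AE \<omega> in M. (\<lambda>k. of_real (indicator (E k) \<omega>) * Z \<omega>) \<longlonglongrightarrow> of_real (indicator D \<omega>) * Z \<omega>"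
    proof (rule AE_I2)
      fix \<omega> assume "\<omega> \<in> space M"
      moreover obtain k0 :: nat where "A t \<omega> \<le> real k0" using real_arch_simple by blast
      ultimately have "eventually (\<lambda>k. indicator (E k) \<omega> = (indicator D \<omega> :: real)) sequentially"
        by (intro eventually_sequentiallyI[of k0]) (auto simp: E_def indicator_def)
      then show "(\<lambda>k. of_real (indicator (E k) \<omega>) * Z \<omega>) \<longlonglongrightarrow> of_real (indicator D \<omega>) * Z \<omega>"
        by (intro tendsto_eventually) (auto elim: eventually_mono)
    qed
  qed (use Z_le in auto)
  moreover have "(\<integral>\<omega>. of_real (indicator (E k) \<omega>) * Z \<omega> \<partial>M) = 0" for k
    unfolding Z_def by (rule mean_compensated_characteristic_bounded[OF mc rt E, where K = "real k"]) (simp add: E_def)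
  ultimately show "(\<integral>\<omega>. of_real (indicator D \<omega>) * Z \<omega> \<partial>M) = 0"
    by (simp add: LIMSEQ_const_iff)
qed

lemma mean_compensated_imp_characteristic_identity:
  assumes mc: "mean_compensated"
  shows "characteristic_identity"
  unfolding characteristic_identity_def
proof (intro allI impI)
  fix u r t :: real assume rt: "0 \<le> r" "r \<le> t"
  interpret Fr: sigma_finite_subalgebra M "F r" by (rule sigma_finite_subalgebra_F[OF rt(1)])
  have t: "0 \<le> t" using rt by simp
  note [measurable] = N_measurable[OF rt(1)] N_measurable[OF t] A_measurable[OF rt(1)] A_measurable[OF t]
  define E where "E = (\<lambda>\<omega>. exp (\<i> * of_real (u * (N t \<omega> - N r \<omega>))))"
  define C where "C = (\<lambda>\<omega>. exp ((exp (\<i> * of_real u) - 1) * of_real (A t \<omega> - A r \<omega>)))"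
  have [measurable]: "E \<in> borel_measurable M" "C \<in> borel_measurable M" unfolding E_def C_def by measurable
  have "integrable M E"
    by (rule integrable_const_bound[where B = 1]) (simp_all only: E_def norm_exp_i_times order_refl AE_I2, measurable)
  moreover have "integrable M C"
    by (rule integrable_const_bound[where B = 1])
       (use norm_compensator_characteristic_le[OF rt, of u] in \<open>simp_all only: C_def\<close>, measurable)
  ultimately have int: "integrable M E" "integrable M C" .
  have "C \<in> borel_measurable (F r)"
  proof -
    note [measurable] = A_measurable_F[OF rt(1) rt(1)] A_measurable_F[OF t rt(1)]
    show ?thesis unfolding C_def by measurable
  qed
  then have C_meas: "(\<lambda>\<omega>. Re (C \<omega>)) \<in> borel_measurable (F r)" "(\<lambda>\<omega>. Im (C \<omega>)) \<in> borel_measurable (F r)"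
    by measurable
  have eq: "(\<integral>\<omega>\<in>D. Re (E \<omega>) \<partial>M) = (\<integral>\<omega>\<in>D. Re (C \<omega>) \<partial>M)"
    "(\<integral>\<omega>\<in>D. Im (E \<omega>) \<partial>M) = (\<integral>\<omega>\<in>D. Im (C \<omega>) \<partial>M)" if D: "D \<in> sets (F r)" for D
  proof -
    have DM [measurable]: "D \<in> sets M" using D rt by (auto intro: sets_F)
    note Z = mean_compensated_characteristic[OF mc rt D, of u, folded fun_cong[OF E_def] fun_cong[OF C_def]]
    have i: "integrable M (\<lambda>\<omega>. indicator D \<omega> * Re (E \<omega>))" "integrable M (\<lambda>\<omega>. indicator D \<omega> * Re (C \<omega>))"
      "integrable M (\<lambda>\<omega>. indicator D \<omega> * Im (E \<omega>))" "integrable M (\<lambda>\<omega>. indicator D \<omega> * Im (C \<omega>))"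
      using int integrable_real_mult_indicator[OF DM, unfolded mult.commute[of _ "indicator D _"]] by auto
    have "(\<integral>\<omega>. indicator D \<omega> * Re (E \<omega>) - indicator D \<omega> * Re (C \<omega>) \<partial>M) = 0"
      using arg_cong[OF Z(2), of Re] integral_Re[OF Z(1)] by (simp add: right_diff_distrib)
    then show "(\<integral>\<omega>\<in>D. Re (E \<omega>) \<partial>M) = (\<integral>\<omega>\<in>D. Re (C \<omega>) \<partial>M)"
      using i by (simp add: set_lebesgue_integral_def)
    have "(\<integral>\<omega>. indicator D \<omega> * Im (E \<omega>) - indicator D \<omega> * Im (C \<omega>) \<partial>M) = 0"
      using arg_cong[OF Z(2), of Im] integral_Im[OF Z(1)] by (simp add: right_diff_distrib)
    then show "(\<integral>\<omega>\<in>D. Im (E \<omega>) \<partial>M) = (\<integral>\<omega>\<in>D. Im (C \<omega>) \<partial>M)"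
      using i by (simp add: set_lebesgue_integral_def)
  qed
  have "AE \<omega> in M. real_cond_exp M (F r) (\<lambda>\<omega>. Re (E \<omega>)) \<omega> = Re (C \<omega>)"
    "AE \<omega> in M. real_cond_exp M (F r) (\<lambda>\<omega>. Im (E \<omega>)) \<omega> = Im (C \<omega>)"
    using int C_meas by (auto intro!: Fr.real_cond_exp_charact eq)
  then show "AE \<omega> in M. complex_cond_exp M (F r) (\<lambda>\<omega>. exp (\<i> * of_real (u * (N t \<omega> - N r \<omega>)))) \<omega>
           = exp ((exp (\<i> * of_real u) - 1) * of_real (A t \<omega> - A r \<omega>))"
    unfolding fun_cong[OF E_def, symmetric] fun_cong[OF C_def, symmetric]
    by eventually_elim (simp add: complex_cond_exp_def)
qed

section \<open>Passing between the means and local martingales\<close>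

lemma A_level_exists:
  assumes "0 \<le> t" "0 < e"
  obtains c where "measure M {\<omega> \<in> space M. c < A t \<omega>} < e"
proof -
  note [measurable] = A_measurable[OF assms(1)]
  let ?S = "\<lambda>k::nat. {\<omega> \<in> space M. real k < A t \<omega>}"
  have "(\<lambda>k. measure M (?S k)) \<longlonglongrightarrow> measure M (\<Inter>k. ?S k)"
    by (rule finite_Lim_measure_decseq) (auto simp: decseq_def)
  moreover have "(\<Inter>k. ?S k) = {}"
    using real_arch_simple by (auto simp: not_less[symmetric])
  ultimately have "(\<lambda>k. measure M (?S k)) \<longlonglongrightarrow> 0" by simp
  then have "eventually (\<lambda>k. measure M (?S k) < e) sequentially"
    using assms(2) by (rule order_tendstoD)
  then show ?thesis using that by (auto simp: eventually_sequentially)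
qed

text \<open>One set has to control \<open>A t\<close> for all \<open>t\<close> at once, and the sets
  have to increase. With \<open>c n\<close> chosen such that \<open>A n > c n\<close> has
  probability below \<open>(1/2) ^ n\<close>, Borel-Cantelli gives \<open>A m \<le> c m\<close> for
  all large \<open>m\<close>, and \<open>B n\<close> says that this holds from \<open>n\<close>
  on.\<close>

lemma F0_localizing_sets:
  obtains B :: "nat \<Rightarrow> 'a set" where
    "\<And>n. B n \<in> sets (F 0)" "incseq B" "AE \<omega> in M. \<exists>n. \<omega> \<in> B n"
    "\<And>n t. 0 \<le> t \<Longrightarrow> \<exists>K. AE \<omega> in M. \<omega> \<in> B n \<longrightarrow> A t \<omega> \<le> K"
proof -
  have "\<exists>c. measure M {\<omega> \<in> space M. c < A (real n) \<omega>} < (1/2) ^ n" for n :: nat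
    by (rule A_level_exists[of "real n" "(1/2) ^ n"]) auto
  then obtain c where c: "measure M {\<omega> \<in> space M. c n < A (real n) \<omega>} < (1/2) ^ n" for n :: nat
    by metis
  note [measurable] = A_measurable[of "real n" for n]
  have AE: "AE \<omega> in M. eventually (\<lambda>n. \<omega> \<in> space M - {\<omega> \<in> space M. c n < A (real n) \<omega>}) sequentially"
  proof (rule borel_cantelli_AE1)
    show "summable (\<lambda>n. measure M {\<omega> \<in> space M. c n < A (real n) \<omega>})"
      by (rule summable_comparison_test'[where g = "\<lambda>n. (1/2) ^ n" and N = 0])
         (use c in \<open>auto intro: less_imp_le\<close>)
  qed (auto simp: less_top[symmetric])
  define B where "B n = {\<omega> \<in> space M. \<forall>m\<ge>n. A (real m) \<omega> \<le> c m}" for n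
  have "B n \<in> sets (F 0)" for n
  proof -
    have "B n = (\<Inter>m\<in>{n..}. {\<omega> \<in> space M. A (real m) \<omega> \<le> c m})" by (auto simp: B_def)
    also have "\<dots> \<in> sets (F 0)" by (intro sets.countable_INT') (auto intro!: A_bounded_F0)
    finally show ?thesis .
  qed
  moreover have "incseq B" by (auto simp: B_def incseq_def)
  moreover have "AE \<omega> in M. \<exists>n. \<omega> \<in> B n"
    using AE by eventually_elim (auto simp: eventually_sequentially B_def not_less)
  moreover have "\<exists>K. AE \<omega> in M. \<omega> \<in> B n \<longrightarrow> A t \<omega> \<le> K" if t: "0 \<le> t" for n t
  proof -
    obtain m :: nat where m: "n \<le> m" "t \<le> real m"
      using real_arch_simple[of t] by (metis max.cobounded1 max.cobounded2 of_nat_le_iff order_trans)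
    \<comment> \<open>Monotonicity carries the bound from the integer time \<open>m\<close> back to
      \<open>t\<close>.\<close>
    have "AE \<omega> in M. \<omega> \<in> B n \<longrightarrow> A t \<omega> \<le> c m"
      using A_bounds[OF t m(2)] by eventually_elim (use m(1) in \<open>fastforce simp: B_def\<close>)
    then show ?thesis by blast
  qed
  ultimately show ?thesis using that by blast
qed

lemma mean_compensated_imp_local_martingale:
  assumes mc: "mean_compensated"
  shows "local_martingale M F Y"
proof -
  obtain B :: "nat \<Rightarrow> 'a set" where B: "\<And>n. B n \<in> sets (F 0)" "incseq B" "AE \<omega> in M. \<exists>n. \<omega> \<in> B n"
    "\<And>n t. 0 \<le> t \<Longrightarrow> \<exists>K. AE \<omega> in M. \<omega> \<in> B n \<longrightarrow> A t \<omega> \<le> K"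
    by (rule F0_localizing_sets) blast
  have BF: "B n \<in> sets (F t)" if "0 \<le> t" for n t using B(1) mono_F[of 0 t] that by auto
  \<comment> \<open>Since \<open>A\<close> is known at time \<open>0\<close>, localizing times with the two values \<open>0\<close> and \<open>\<infinity>\<close> suffice.\<close>
  define \<tau> where "\<tau> n \<omega> = (if \<omega> \<in> B n then \<infinity> else 0 :: ennreal)" for n \<omega>
  have Y_meas: "Y s \<in> borel_measurable (F t)" if "0 \<le> s" "s \<le> t" for s t
    using N_measurable_F[OF that] A_measurable_F[of s t] that by (intro borel_measurable_diff) auto
  have stopped: "stopped_process Y (\<tau> n) t = (\<lambda>\<omega>. if \<omega> \<in> B n then Y t \<omega> else Y 0 \<omega>)" if "0 \<le> t" for n t
    using that by (auto simp: stopped_process_def \<tau>_def fun_eq_iff)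
  have "martingale M F (stopped_process Y (\<tau> n))" for n
  proof -
    let ?S = "stopped_process Y (\<tau> n)"
    have meas: "?S t \<in> borel_measurable (F t)" if t: "0 \<le> t" for t
    proof -
      have "{\<omega> \<in> space (F t). \<omega> \<in> B n} = B n"
        using sets.sets_into_space[OF BF[OF t, of n]] by auto
      then show ?thesis unfolding stopped[OF t]
        using BF[OF t, of n] by (intro measurable_If[OF Y_meas[OF t order_refl] Y_meas[OF order_refl t]]) simp
    qed
    \<comment> \<open>Off \<open>B n\<close> the process is frozen at \<open>Y 0\<close>, which is
      almost surely \<open>0\<close>. So stopping amounts to restricting \<open>Y\<close> to an
      event of \<open>F 0\<close>.\<close>
    have AE_S: "AE \<omega> in M. ?S t \<omega> = indicator (B n) \<omega> * Y t \<omega>" if t: "0 \<le> t" for t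
      using Y_0 unfolding stopped[OF t] by eventually_elim auto
    have int_N: "integrable M (\<lambda>\<omega>. indicator (B n) \<omega> * N t \<omega>)" if t: "0 \<le> t" for t
      using mc B(4)[OF t, of n] B(1)[of n] t unfolding mean_compensated_def by blast
    have BM: "B n \<in> sets M" using B(1) sets_F by blast
    have int_Y: "integrable M (\<lambda>\<omega>. indicator (B n) \<omega> * Y t \<omega>)" if t: "0 \<le> t" for t
    proof -
      obtain K where "AE \<omega> in M. \<omega> \<in> B n \<longrightarrow> A t \<omega> \<le> K" using B(4)[OF t] by blast
      then show ?thesis by (rule integrable_Y_on[OF BM _ int_N[OF t] t order_refl])
    qed
    have int: "integrable M (?S t)" if t: "0 \<le> t" for t
      using int_Y[OF t] AE_S[OF t] measurable_F_M[OF meas[OF t] t]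
      by (subst integrable_cong_AE) auto
    have "AE \<omega> in M. real_cond_exp M (F s) (?S t) \<omega> = ?S s \<omega>" if st: "0 \<le> s" "s \<le> t" for s t
    proof -
      interpret Fs: sigma_finite_subalgebra M "F s" by (rule sigma_finite_subalgebra_F[OF st(1)])
      have t: "0 \<le> t" using st by simp
      show ?thesis
      proof (rule Fs.real_cond_exp_charact)
        fix E assume E: "E \<in> sets (F s)"
        have EM: "E \<in> sets M" using E sets_F st by blast
        have S_eq: "(\<integral>\<omega>\<in>E. ?S v \<omega> \<partial>M) = (\<integral>\<omega>. indicator E \<omega> * (indicator (B n) \<omega> * Y v \<omega>) \<partial>M)"
          if v: "0 \<le> v" for v
          unfolding set_lebesgue_integral_def
          using AE_S[OF v] EM BM measurable_F_M[OF meas[OF v] v] N_measurable[OF v] A_measurable[OF v]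
          by (intro integral_cong_AE) auto
        have i: "integrable M (\<lambda>\<omega>. indicator E \<omega> * (indicator (B n) \<omega> * Y v \<omega>))" if v: "0 \<le> v" for v
          using integrable_real_mult_indicator[OF EM int_Y[OF v]] by (simp add: mult.commute)
        have "(\<integral>\<omega>. indicator (E \<inter> B n) \<omega> * (Y t \<omega> - Y s \<omega>) \<partial>M) = 0"
        proof -
          obtain K where "AE \<omega> in M. \<omega> \<in> B n \<longrightarrow> A t \<omega> \<le> K" using B(4)[OF t] by blast
          then have "AE \<omega> in M. \<omega> \<in> E \<inter> B n \<longrightarrow> A t \<omega> \<le> K" by eventually_elim auto
          then show ?thesis
            using mc st sets.Int[OF E BF[OF st(1), of n]] unfolding mean_compensated_def by blast
        qed
        also have "(\<lambda>\<omega>. indicator (E \<inter> B n) \<omega> * (Y t \<omega> - Y s \<omega>)) =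
          (\<lambda>\<omega>. indicator E \<omega> * (indicator (B n) \<omega> * Y t \<omega>) - indicator E \<omega> * (indicator (B n) \<omega> * Y s \<omega>))"
          by (simp only: indicator_inter_arith right_diff_distrib mult.assoc)
        finally have "(\<integral>\<omega>. indicator E \<omega> * (indicator (B n) \<omega> * Y t \<omega>) \<partial>M) =
            (\<integral>\<omega>. indicator E \<omega> * (indicator (B n) \<omega> * Y s \<omega>) \<partial>M)"
          unfolding Bochner_Integration.integral_diff[OF i[OF t] i[OF st(1)]] by simp
        then show "(\<integral>\<omega>\<in>E. ?S t \<omega> \<partial>M) = (\<integral>\<omega>\<in>E. ?S s \<omega> \<partial>M)"
          using S_eq[OF t] S_eq[OF st(1)] by simp
      qed (use int st t meas in auto)
    qed
    with meas int show ?thesis by (auto simp: martingale_def adapted_process_def)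
  qed
  moreover have "ext_stopping_time F (\<tau> n)" for n
    unfolding ext_stopping_time_def
  proof (intro allI impI)
    fix t :: real assume t: "0 \<le> t"
    note [measurable] = BF[OF t, of n]
    have "(\<lambda>\<omega>. \<tau> n \<omega> \<le> ennreal t) = (\<lambda>\<omega>. \<omega> \<notin> B n)" by (auto simp: \<tau>_def fun_eq_iff top_unique)
    then show "Measurable.pred (F t) (\<lambda>\<omega>. \<tau> n \<omega> \<le> ennreal t)" by simp
  qed
  moreover have "AE \<omega> in M. incseq (\<lambda>n. \<tau> n \<omega>) \<and> (\<lambda>n. \<tau> n \<omega>) \<longlonglongrightarrow> \<infinity>"
    using B(3)
  proof eventually_elim
    case (elim \<omega>)
    then obtain n where n: "\<omega> \<in> B n" by blast
    have up: "\<omega> \<in> B m'" if "\<omega> \<in> B m" "m \<le> m'" for m m' using B(2) that by (auto simp: incseq_def)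
    then have "incseq (\<lambda>n. \<tau> n \<omega>)" by (auto simp: incseq_def \<tau>_def)
    moreover have "eventually (\<lambda>m. \<tau> m \<omega> = \<infinity>) sequentially"
      using up[OF n] by (auto simp: eventually_sequentially \<tau>_def)
    ultimately show ?case by (auto intro: tendsto_eventually)
  qed
  moreover have "adapted_process F Y" using Y_meas by (auto simp: adapted_process_def)
  moreover have "AE \<omega> in M. cadlag (\<lambda>t. Y t \<omega>)"
    using N_cadlag A_path by eventually_elim (auto simp: compensator_path_def intro: cadlag_diff_continuous)
  ultimately show ?thesis unfolding local_martingale_def by blast
qed

text \<open>Here the localizing times are arbitrary. The martingale property on the event
  \<open>A t \<le> K\<close> first gives integrability of \<open>N t\<close> there; after that
  \<open>N t\<close> plus a constant dominates all stopped processes, and the means pass to the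
  limit.\<close>

lemma local_martingale_imp_mean_compensated:
  assumes lm: "local_martingale M F Y"
  shows "mean_compensated"
proof -
  obtain \<tau> :: "nat \<Rightarrow> 'a \<Rightarrow> ennreal" where
    lim: "AE \<omega> in M. (\<lambda>n. \<tau> n \<omega>) \<longlonglongrightarrow> \<infinity>" and mart: "\<And>n. martingale M F (stopped_process Y (\<tau> n))"
    using lm by (auto simp: local_martingale_def)
  define S where "S n = stopped_process Y (\<tau> n)" for n
  have S_int: "integrable M (S n t)" if "0 \<le> t" for n t
    using mart[of n] that by (auto simp: S_def martingale_def)
  have S_measurable [measurable]: "S n t \<in> borel_measurable M" if "0 \<le> t" for n t
    using S_int[OF that] by simp
  have S_mart: "(\<integral>\<omega>. indicator D \<omega> * S n t \<omega> \<partial>M) = (\<integral>\<omega>. indicator D \<omega> * S n s \<omega> \<partial>M)"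
    if st: "0 \<le> s" "s \<le> t" and D: "D \<in> sets (F s)" for n s t D
  proof -
    interpret Fs: sigma_finite_subalgebra M "F s" by (rule sigma_finite_subalgebra_F[OF st(1)])
    have t: "0 \<le> t" using st by simp
    have [measurable]: "D \<in> sets M" using D sets_F st by blast
    have AE: "AE \<omega> in M. real_cond_exp M (F s) (S n t) \<omega> = S n s \<omega>"
      using mart[of n] st by (auto simp: S_def martingale_def)
    have "(\<integral>\<omega>. indicator D \<omega> * S n t \<omega> \<partial>M) = (\<integral>\<omega>. indicator D \<omega> * real_cond_exp M (F s) (S n t) \<omega> \<partial>M)"
      using Fs.real_cond_exp_intA[OF S_int[OF t] D, of n] by (simp add: set_lebesgue_integral_def)
    also have "\<dots> = (\<integral>\<omega>. indicator D \<omega> * S n s \<omega> \<partial>M)"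
      using AE S_measurable[OF st(1), of n] by (intro integral_cong_AE) auto
    finally show ?thesis .
  qed
  \<comment> \<open>As \<open>\<tau> n\<close> tends to \<open>\<infinity>\<close>, stopping has no
    effect at time \<open>t\<close> for large \<open>n\<close>: the stopped values become equal to
    \<open>Y t\<close>, not just close to it.\<close>
  have S_lim: "AE \<omega> in M. eventually (\<lambda>n. S n t \<omega> = Y t \<omega>) sequentially" if t: "0 \<le> t" for t
    using lim
  proof eventually_elim
    case (elim \<omega>)
    have "eventually (\<lambda>n. ennreal t < \<tau> n \<omega>) sequentially"
      using order_tendstoD(1)[OF elim, of "ennreal t"] by simp
    then show ?case
      by eventually_elim (simp add: S_def stopped_process_def t)
  qed
  \<comment> \<open>A stopped value is \<open>N v - A v\<close> at a random time
    \<open>v \<le> t\<close>, and both paths increase from \<open>0\<close>.\<close>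
  have S_bounds: "AE \<omega> in M. - A t \<omega> \<le> S n s \<omega> \<and> S n s \<omega> \<le> N t \<omega>" if st: "0 \<le> s" "s \<le> t" for n s t
    using N_path A_path
  proof eventually_elim
    case (elim \<omega>)
    have v: "0 \<le> enn2real (min (ennreal s) (\<tau> n \<omega>))" "enn2real (min (ennreal s) (\<tau> n \<omega>)) \<le> t"
      using enn2real_min_time(1,2)[OF st(1)] st(2) order_trans by blast+
    show ?case
      using simple_counting_path_bounds[OF elim(1) v] compensator_path_bounds[OF elim(2) v]
      by (simp add: S_def stopped_process_def)
  qed
  have S_0: "AE \<omega> in M. S n 0 \<omega> = 0" for n
    using Y_0 by eventually_elim (simp add: S_def stopped_process_def)
  show ?thesis
    unfolding mean_compensated_def
  proof (intro allI impI)
    fix r t K D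
    assume rt: "0 \<le> r" "r \<le> t" and D: "D \<in> sets (F r)" and K: "AE \<omega> in M. \<omega> \<in> D \<longrightarrow> A t \<omega> \<le> K"
    then have t: "0 \<le> t" by simp
    have DM [measurable]: "D \<in> sets M" using D rt sets_F by blast
    note [measurable] = N_measurable[OF t] A_measurable[OF t] S_measurable[OF t] S_measurable[OF rt(1)]
    define B where "B = {\<omega> \<in> space M. A t \<omega> \<le> K}"
    have B: "B \<in> sets (F 0)" unfolding B_def using t by (rule A_bounded_F0)
    have BM [measurable]: "B \<in> sets M" using B by (rule sets_F[rotated]) simp
    have SK: "AE \<omega> in M. 0 \<le> indicator B \<omega> * (S n t \<omega> + K)" for n
      using S_bounds[OF t order_refl, of n] by eventually_elim (auto simp: B_def indicator_def)
    have SK_int: "integrable M (\<lambda>\<omega>. indicator B \<omega> * (S n t \<omega> + K))" for n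
      using integrable_real_mult_indicator[OF BM, of "\<lambda>\<omega>. S n t \<omega> + K"] S_int[OF t, of n]
      by (simp add: mult.commute)
    \<comment> \<open>Since \<open>B\<close> lies in \<open>F 0\<close> and the stopped process
      starts at \<open>0\<close>, the integral is the same for all \<open>n\<close>. This is the
      bound that Fatou's lemma needs.\<close>
    have SK_eq: "(\<integral>\<omega>. indicator B \<omega> * (S n t \<omega> + K) \<partial>M) = K * measure M B" for n
    proof -
      have i: "integrable M (\<lambda>\<omega>. indicator B \<omega> * S n t \<omega>)"
        using integrable_real_mult_indicator[OF BM S_int[OF t, of n]] by (simp add: mult.commute)
      have "(\<integral>\<omega>. indicator B \<omega> * S n t \<omega> \<partial>M) = (\<integral>\<omega>. indicator B \<omega> * S n 0 \<omega> \<partial>M)"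
        by (rule S_mart[OF order_refl t B])
      also have "\<dots> = (\<integral>\<omega>. 0 \<partial>M)"
        using S_0[of n] S_measurable[of 0 n] by (intro integral_cong_AE) auto
      finally have "(\<integral>\<omega>. indicator B \<omega> * S n t \<omega> \<partial>M) = 0" by simp
      moreover have "(\<lambda>\<omega>. indicator B \<omega> * (S n t \<omega> + K)) = (\<lambda>\<omega>. indicator B \<omega> * S n t \<omega> + K * indicator B \<omega>)"
        by (simp add: algebra_simps)
      moreover have "integrable M (\<lambda>\<omega>. K * indicator B \<omega>)"
        by (intro integrable_mult_right integrable_real_indicator) (auto simp: less_top[symmetric])
      ultimately show ?thesis using i by simp
    qed
    \<comment> \<open>Adding \<open>K\<close> makes the stopped process nonnegative on \<open>B\<close>, so that Fatou's lemma applies.\<close>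
    have "(\<integral>\<^sup>+\<omega>. ennreal (indicator B \<omega> * (Y t \<omega> + K)) \<partial>M) \<le>
        (\<integral>\<^sup>+\<omega>. liminf (\<lambda>n. ennreal (indicator B \<omega> * (S n t \<omega> + K))) \<partial>M)"
    proof (rule nn_integral_mono_AE)
      show "AE \<omega> in M. ennreal (indicator B \<omega> * (Y t \<omega> + K)) \<le> liminf (\<lambda>n. ennreal (indicator B \<omega> * (S n t \<omega> + K)))"
        using S_lim[OF t]
      proof eventually_elim
        case (elim \<omega>)
        then have "(\<lambda>n. ennreal (indicator B \<omega> * (S n t \<omega> + K))) \<longlonglongrightarrow> ennreal (indicator B \<omega> * (Y t \<omega> + K))"
          by (intro tendsto_eventually) (auto elim: eventually_mono)
        then show ?case by (simp add: lim_imp_Liminf)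
      qed
    qed
    also have "\<dots> \<le> liminf (\<lambda>n. \<integral>\<^sup>+\<omega>. ennreal (indicator B \<omega> * (S n t \<omega> + K)) \<partial>M)"
      by (rule nn_integral_liminf) measurable
    also have "\<dots> = liminf (\<lambda>n. ennreal (K * measure M B))"
      using nn_integral_eq_integral[OF SK_int SK] by (simp add: SK_eq)
    also have "\<dots> < \<infinity>" by (simp add: Liminf_const)
    finally have fin: "(\<integral>\<^sup>+\<omega>. ennreal (indicator B \<omega> * (Y t \<omega> + K)) \<partial>M) < \<infinity>" .
    have "integrable M (\<lambda>\<omega>. indicator B \<omega> * (Y t \<omega> + K))"
    proof (rule integrableI_nonneg)
      show "AE \<omega> in M. 0 \<le> indicator B \<omega> * (Y t \<omega> + K)"
        using N_bounds[OF t order_refl] by eventually_elim (auto simp: B_def indicator_def)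
    qed (use fin in auto)
    then have "integrable M (\<lambda>\<omega>. indicator B \<omega> * N t \<omega>)"
    proof (rule Bochner_Integration.integrable_bound[OF Bochner_Integration.integrable_add])
      show "integrable M (\<lambda>\<omega>. \<bar>K\<bar>)" by simp
      show "AE \<omega> in M. norm (indicator B \<omega> * N t \<omega>) \<le> norm (indicator B \<omega> * (Y t \<omega> + K) + \<bar>K\<bar>)"
        using N_bounds[OF t order_refl] A_bounds[OF t order_refl]
        by eventually_elim (auto simp: B_def indicator_def)
    qed measurable
    then have int_N: "integrable M (\<lambda>\<omega>. indicator D \<omega> * N t \<omega>)"
      by (rule integrable_indicator_subset) (use K DM t sets.sets_into_space[OF DM] in \<open>auto simp: B_def\<close>)
    have dom: "AE \<omega> in M. norm (indicator D \<omega> * S n s \<omega>) \<le> indicator D \<omega> * N t \<omega> + \<bar>K\<bar>" if "0 \<le> s" "s \<le> t" for n s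
      using S_bounds[OF that, of n] K N_bounds[OF t order_refl]
      by eventually_elim (auto simp: indicator_def abs_le_iff)
    have conv: "(\<lambda>n. \<integral>\<omega>. indicator D \<omega> * S n s \<omega> \<partial>M) \<longlonglongrightarrow> (\<integral>\<omega>. indicator D \<omega> * Y s \<omega> \<partial>M)"
      if s: "0 \<le> s" "s \<le> t" for s
    proof (rule integral_dominated_convergence[where w = "\<lambda>\<omega>. indicator D \<omega> * N t \<omega> + \<bar>K\<bar>"])
      show "AE \<omega> in M. (\<lambda>n. indicator D \<omega> * S n s \<omega>) \<longlonglongrightarrow> indicator D \<omega> * Y s \<omega>"
        using S_lim[OF s(1)] by eventually_elim (auto intro!: tendsto_eventually elim: eventually_mono)
    qed (use int_N dom[OF s] S_measurable[OF s(1)] N_measurable[OF s(1)] A_measurable[OF s(1)] in auto)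
    have "(\<integral>\<omega>. indicator D \<omega> * Y t \<omega> \<partial>M) = (\<integral>\<omega>. indicator D \<omega> * Y r \<omega> \<partial>M)"
      using conv[OF t order_refl] conv[OF rt] unfolding S_mart[OF rt D] by (rule LIMSEQ_unique)
    moreover have "(\<integral>\<omega>. indicator D \<omega> * (Y t \<omega> - Y r \<omega>) \<partial>M) =
        (\<integral>\<omega>. indicator D \<omega> * Y t \<omega> \<partial>M) - (\<integral>\<omega>. indicator D \<omega> * Y r \<omega> \<partial>M)"
      unfolding right_diff_distrib[of _ "Y t _"]
      by (rule Bochner_Integration.integral_diff[OF
            integrable_Y_on[OF DM K int_N t order_refl] integrable_Y_on[OF DM K int_N rt]])
    ultimately show "integrable M (\<lambda>\<omega>. indicator D \<omega> * N t \<omega>) \<and>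
        (\<integral>\<omega>. indicator D \<omega> * (Y t \<omega> - Y r \<omega>) \<partial>M) = 0" using int_N by simp
  qed
qed

end

section \<open>Paths of the point process and of the integrated intensity\<close>

context
  fixes T :: "nat \<Rightarrow> 'a \<Rightarrow> ennreal" and \<omega> :: 'a
  assumes step: "\<And>n. T (Suc n) \<omega> < \<infinity> \<Longrightarrow> T n \<omega> < T (Suc n) \<omega>"
    and fin: "\<And>k::nat. simple_point_process T (real k) \<omega> < \<infinity>"
begin

text \<open>Index \<open>n\<close> stands for the time \<open>T (Suc n)\<close>, as
  \<open>T 0\<close> is not counted.\<close>

private definition S where "S t = {n. T (Suc n) \<omega> \<le> ennreal t}"
text \<open>An infinite time becomes \<open>0\<close> under \<open>enn2real\<close>, so
  \<open>x n\<close> is an arrival time only if \<open>T (Suc n) \<omega>\<close> is finite;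
  \<open>S_iff\<close> and \<open>x_inj\<close> carry that condition.\<close>

private definition x where "x n = enn2real (T (Suc n) \<omega>)"

private lemma simple_point_process_card:
  "simple_point_process T t \<omega> = (if finite (S t) then of_nat (card (S t)) else \<infinity>)"
proof -
  have "simple_point_process T t \<omega> = (\<Sum>n. indicator (S t) n)"
    by (simp add: simple_point_process_def S_def indicator_def)
  also have "\<dots> = (\<integral>\<^sup>+n. indicator (S t) n \<partial>count_space UNIV)"
    by (rule nn_integral_count_space_nat[symmetric])
  also have "\<dots> = emeasure (count_space UNIV) (S t)" by simp
  finally show ?thesis by (simp add: emeasure_count_space)
qed

private lemma S_mono: "s \<le> t \<Longrightarrow> S s \<subseteq> S t"
  by (auto simp: S_def intro: order_trans ennreal_leI)

private lemma finite_S: "finite (S t)"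
proof -
  obtain k :: nat where "t \<le> real k" using real_arch_simple by blast
  moreover have "finite (S (real k))"
    using fin[of k] by (auto simp: simple_point_process_card split: if_splits)
  ultimately show ?thesis using S_mono finite_subset by blast
qed

private lemma N_card: "enn2real (simple_point_process T t \<omega>) = real (card (S t))"
  by (simp add: simple_point_process_card finite_S)

private lemma S_iff: "0 \<le> t \<Longrightarrow> n \<in> S t \<longleftrightarrow> T (Suc n) \<omega> < \<infinity> \<and> x n \<le> t"
  by (cases "T (Suc n) \<omega>") (auto simp: S_def x_def top_unique)

private lemma T_strict: "n < m \<Longrightarrow> T m \<omega> < \<infinity> \<Longrightarrow> T n \<omega> < T m \<omega>"
proof (induction m)
  case (Suc m)
  have "T m \<omega> < T (Suc m) \<omega>" by (rule step[OF Suc.prems(2)])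
  with Suc show ?case by (cases "n = m") (auto dest: less_trans)
qed simp

private lemma x_inj: "n \<noteq> m \<Longrightarrow> T (Suc n) \<omega> < \<infinity> \<Longrightarrow> T (Suc m) \<omega> < \<infinity> \<Longrightarrow> x n \<noteq> x m"
proof (induction n m rule: linorder_wlog)
  case (le n m)
  then have "T (Suc n) \<omega> < T (Suc m) \<omega>" by (intro T_strict) auto
  then show ?case using le
    by (cases "T (Suc n) \<omega>"; cases "T (Suc m) \<omega>") (auto simp: x_def)
qed auto

lemma simple_point_process_path:
  "simple_counting_path (\<lambda>t. enn2real (simple_point_process T t \<omega>))"
  unfolding simple_counting_path_def N_card
proof (intro conjI allI impI)
  \<comment> \<open>A time \<open>T (Suc n)\<close> equal to \<open>0\<close> is finite, so its
    predecessor would have to be less than \<open>0\<close>.\<close>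
  have "S 0 = {}"
  proof (rule ccontr)
    assume "S 0 \<noteq> {}"
    then obtain n where "T (Suc n) \<omega> = 0" by (auto simp: S_def)
    with step[of n] show False by simp
  qed
  then show "real (card (S 0)) = 0" by simp
  show "mono_on {0..} (\<lambda>t. real (card (S t)))"
    by (auto intro!: mono_onI card_mono finite_S S_mono)
  show "real (card (S t)) \<in> \<nat>" for t by simp
  show "\<exists>\<delta>>0. \<forall>a b. 0 \<le> a \<longrightarrow> a \<le> b \<longrightarrow> b \<le> t \<longrightarrow> b - a < \<delta> \<longrightarrow> real (card (S b)) - real (card (S a)) \<le> 1" for t
  proof -
    \<comment> \<open>\<open>W\<close> holds the distances between different arrivals up to
      \<open>t\<close>. The \<open>1\<close> inserted in \<open>\<delta>\<close> keeps the minimum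
      meaningful when there is at most one arrival.\<close>
    define W where "W = (\<lambda>(n, m). \<bar>x n - x m\<bar>) ` {(n, m) \<in> S t \<times> S t. n \<noteq> m}"
    have "finite W" unfolding W_def
      by (intro finite_imageI finite_subset[OF _ finite_cartesian_product[OF finite_S[of t] finite_S[of t]]]) auto
    define \<delta> where "\<delta> = Min (insert 1 W)"
    have "T (Suc n) \<omega> < \<infinity>" if "n \<in> S t" for n
      using that unfolding S_def by (auto intro: le_less_trans)
    then have "\<forall>w\<in>insert 1 W. 0 < w" using x_inj by (fastforce simp: W_def)
    then have "\<delta> > 0" using \<open>finite W\<close> unfolding \<delta>_def by (subst Min_gr_iff) auto
    moreover have "real (card (S b)) - real (card (S a)) \<le> 1" if ab: "0 \<le> a" "a \<le> b" "b \<le> t" "b - a < \<delta>" for a b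
    proof -
      have "n = m" if n: "n \<in> S b - S a" and m: "m \<in> S b - S a" for n m
      proof (rule ccontr)
        assume "n \<noteq> m"
        then have "\<bar>x n - x m\<bar> \<in> W" using n m S_mono[OF ab(3)] by (force simp: W_def)
        then have "\<delta> \<le> \<bar>x n - x m\<bar>" unfolding \<delta>_def using \<open>finite W\<close> by (intro Min_le) auto
        moreover have "a < x n" "x n \<le> b" "a < x m" "x m \<le> b" using n m ab S_iff by auto
        ultimately show False using ab by auto
      qed
      then have "card (S b - S a) \<le> Suc 0"
        using finite_S[of b] by (subst card_le_Suc0_iff_eq) auto
      moreover have "card (S b - S a) = card (S b) - card (S a)"
        by (rule card_Diff_subset[OF finite_S S_mono[OF ab(2)]])
      ultimately show ?thesis by linarith
    qed
    ultimately show ?thesis by blast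
  qed
qed

text \<open>On either side of \<open>t\<close> the path is locally constant. Only finitely many
  arrivals occur up to \<open>t + 1\<close>, so just after \<open>t\<close> none is added, and just
  before \<open>t\<close> exactly those earlier than \<open>t\<close> have been counted.\<close>

lemma simple_point_process_cadlag:
  "cadlag (\<lambda>t. enn2real (simple_point_process T t \<omega>))"
  unfolding cadlag_def N_card
proof (intro conjI allI impI)
  fix t :: real assume t: "0 \<le> t"
  have "eventually (\<lambda>s. \<forall>n\<in>S (t + 1). n \<in> S s \<longrightarrow> n \<in> S t) (at_right t)"
  proof (intro eventually_ball_finite finite_S ballI)
    fix n assume n: "n \<in> S (t + 1)"
    show "eventually (\<lambda>s. n \<in> S s \<longrightarrow> n \<in> S t) (at_right t)"
    proof (cases "x n \<le> t")
      case True
      then have "n \<in> S t" using n t by (auto simp: S_iff)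
      then show ?thesis by simp
    next
      case False
      then show ?thesis unfolding eventually_at_right_field using S_iff t
        by (intro exI[of _ "x n"]) auto
    qed
  qed
  moreover have "eventually (\<lambda>s. t < s \<and> s < t + 1) (at_right t)"
    unfolding eventually_at_right_field by (intro exI[of _ "t + 1"]) auto
  ultimately have "eventually (\<lambda>s. S s = S t) (at_right t)"
  proof eventually_elim
    case (elim s)
    then show ?case using S_mono[of t s] S_mono[of s "t + 1"] by auto
  qed
  then show "((\<lambda>s. real (card (S s))) \<longlongrightarrow> real (card (S t))) (at_right t)"
    by (intro tendsto_eventually) (auto elim: eventually_mono)
next
  fix t :: real assume t: "0 < t"
  define L where "L = {n \<in> S t. x n < t}"
  have "eventually (\<lambda>s. \<forall>n\<in>L. n \<in> S s) (at_left t)"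
  proof (intro eventually_ball_finite ballI)
    show "finite L" using finite_S[of t] by (simp add: L_def)
    fix n assume n: "n \<in> L"
    moreover have "0 \<le> x n" by (simp add: x_def)
    ultimately show "eventually (\<lambda>s. n \<in> S s) (at_left t)"
      unfolding eventually_at_left_field using S_iff t
      by (intro exI[of _ "x n"]) (auto simp: L_def)
  qed
  moreover have "eventually (\<lambda>s. 0 < s \<and> s < t) (at_left t)"
    unfolding eventually_at_left_field using t by blast
  ultimately have "eventually (\<lambda>s. S s = L) (at_left t)"
  proof eventually_elim
    case (elim s)
    then show ?case using S_iff[of s] S_iff[of t] by (auto simp: L_def)
  qed
  then have "((\<lambda>s. real (card (S s))) \<longlongrightarrow> real (card L)) (at_left t)"
    by (intro tendsto_eventually) (auto elim: eventually_mono)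
  then show "\<exists>l. ((\<lambda>s. real (card (S s))) \<longlongrightarrow> l) (at_left t)" by blast
qed

end

section \<open>Paths and measurability of the integrated intensity\<close>

context
  fixes g :: "real \<Rightarrow> real"
  assumes int: "\<And>t. 0 \<le> t \<Longrightarrow> set_integrable lborel {0..t} g"
    and nonneg: "\<And>s. 0 \<le> s \<Longrightarrow> 0 \<le> g s"
begin

lemma set_integral_diff_initial:
  assumes "0 \<le> r" "r \<le> t"
  shows "(LBINT s:{0..t}. g s) - (LBINT s:{0..r}. g s) = (LBINT s:{r..t}. g s)"
proof -
  have t: "0 \<le> t" using assms by simp
  have rt: "set_integrable lborel {r..t} g"
    by (rule set_integrable_subset[OF int[OF t]]) (use assms in auto)
  have "integral {0..r} g + integral {r..t} g = integral {0..t} g"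
    by (rule Henstock_Kurzweil_Integration.integral_combine)
       (use assms set_borel_integral_eq_integral(1)[OF int[OF t]] in auto)
  then show ?thesis
    using set_borel_integral_eq_integral(2)[OF int[OF t]] set_borel_integral_eq_integral(2)[OF int[OF assms(1)]]
      set_borel_integral_eq_integral(2)[OF rt] by simp
qed

lemma compensator_path_set_integral: "compensator_path (\<lambda>t. LBINT s:{0..t}. g s)"
  unfolding compensator_path_def
proof (intro conjI)
  have eq: "(LBINT s:{0..t}. g s) = integral {0..t} g" if "0 \<le> t" for t
    using set_borel_integral_eq_integral(2)[OF int[OF that]] .
  show "(LBINT s:{0..0}. g s) = 0" unfolding eq[OF order_refl] by simp
  show "mono_on {0..} (\<lambda>t. LBINT s:{0..t}. g s)"
  proof (rule mono_onI)
    fix r t :: real assume rt: "r \<in> {0..}" "t \<in> {0..}" "r \<le> t"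
    have "0 \<le> (LBINT s:{r..t}. g s)"
      unfolding set_lebesgue_integral_def
      using rt nonneg by (intro Bochner_Integration.integral_nonneg) (auto simp: indicator_def)
    then show "(LBINT s:{0..r}. g s) \<le> (LBINT s:{0..t}. g s)"
      using set_integral_diff_initial[of r t] rt by simp
  qed
  have "continuous_on {0..} (\<lambda>t. integral {0..t} g)"
    unfolding continuous_on_def
  proof (rule ballI)
    fix t :: real assume t: "t \<in> {0..}"
    have "continuous_on {0..t + 1} (\<lambda>t. integral {0..t} g)"
      using t by (intro indefinite_integral_continuous_1 set_borel_integral_eq_integral(1) int) auto
    then have "((\<lambda>t. integral {0..t} g) \<longlongrightarrow> integral {0..t} g) (at t within {0..t + 1})"
      using t by (simp add: continuous_on_def)
    moreover have "at t within {0..} = at t within {0..t + 1}"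
      by (rule at_within_nhd[of t "{..<t + 1}"]) auto
    ultimately show "((\<lambda>t. integral {0..t} g) \<longlongrightarrow> integral {0..t} g) (at t within {0..})" by simp
  qed
  then show "continuous_on {0..} (\<lambda>t. LBINT s:{0..t}. g s)"
    by (rule continuous_on_eq) (simp add: eq)
qed

end

text \<open>Nothing is known about \<open>X\<close> at negative times. Replacing \<open>s\<close> by
  \<open>max 0 s\<close> extends the process measurably to the whole line, and the exchanged pair
  puts the parameter \<open>\<omega>\<close> of the later integrals first.\<close>

lemma F0_measurable_process_clamped:
  assumes "F0_measurable_process F X"
  shows "(\<lambda>(\<omega>, s). X (max 0 s) \<omega>) \<in> borel_measurable (F 0 \<Otimes>\<^sub>M lborel)"
proof -
  have "(\<lambda>p. (max 0 (snd p) :: real, fst p)) \<in> measurable (F 0 \<Otimes>\<^sub>M lborel) (restrict_space borel {0..} \<Otimes>\<^sub>M F 0)"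
    by (intro measurable_Pair measurable_restrict_space2) auto
  from measurable_compose[OF this assms[unfolded F0_measurable_process_def]]
  show ?thesis by (simp add: case_prod_beta')
qed

lemma indicator_clamp: "indicator {0..t} s *\<^sub>R g (s :: real) = indicator {0..t} s * (g (max 0 s) :: real)"
  by (simp add: indicator_def)

lemma F0_measurable_process_integral:
  assumes "F0_measurable_process F X"
  shows "(\<lambda>\<omega>. LBINT s:{0..t}. X s \<omega>) \<in> borel_measurable (F 0)"
proof -
  note [measurable] = F0_measurable_process_clamped[OF assms]
  have "(\<lambda>\<omega>. \<integral>s. indicator {0..t} s * X (max 0 s) \<omega> \<partial>lborel) \<in> borel_measurable (F 0)"
    by (rule lborel.borel_measurable_lebesgue_integral) measurable
  then show ?thesis
    unfolding set_lebesgue_integral_def indicator_clamp[of _ _ "\<lambda>s. X s _"] .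
qed

lemma F0_measurable_process_set_integrable:
  assumes "F0_measurable_process F X" "\<omega> \<in> space (F 0)" "\<And>s. 0 \<le> s \<Longrightarrow> 0 \<le> X s \<omega>"
    and "(\<integral>\<^sup>+ s\<in>{0..t}. ennreal (X s \<omega>) \<partial>lborel) < \<infinity>"
  shows "set_integrable lborel {0..t} (\<lambda>s. X s \<omega>)"
  unfolding set_integrable_def
proof (rule integrableI_nonneg)
  have "(\<lambda>s. X (max 0 s) \<omega>) \<in> borel_measurable lborel"
    using measurable_compose[OF measurable_Pair1'[OF assms(2)] F0_measurable_process_clamped[OF assms(1)]]
    by simp
  then show "(\<lambda>s. indicator {0..t} s *\<^sub>R X s \<omega>) \<in> borel_measurable lborel"
    unfolding indicator_clamp[of _ _ "\<lambda>s. X s \<omega>"] by measurable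
  show "AE s in lborel. 0 \<le> indicator {0..t} s *\<^sub>R X s \<omega>"
    using assms(3) by (auto simp: indicator_def)
  have "(\<integral>\<^sup>+ s. ennreal (indicator {0..t} s *\<^sub>R X s \<omega>) \<partial>lborel) = (\<integral>\<^sup>+ s\<in>{0..t}. ennreal (X s \<omega>) \<partial>lborel)"
    by (intro nn_integral_cong) (simp add: indicator_def)
  with assms(4) show "(\<integral>\<^sup>+ s. ennreal (indicator {0..t} s *\<^sub>R X s \<omega>) \<partial>lborel) < \<infinity>" by simp
qed

lemma simple_point_process_measurable:
  assumes "\<And>n. ext_stopping_time F (T n)" "0 \<le> t"
  shows "simple_point_process T t \<in> borel_measurable (F t)"
proof -
  have ind: "(\<lambda>\<omega>. indicator {\<omega>. T (Suc n) \<omega> \<le> ennreal t} \<omega> :: ennreal) \<in> borel_measurable (F t)" for n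
  proof -
    have [measurable]: "Measurable.pred (F t) (\<lambda>\<omega>. T (Suc n) \<omega> \<le> ennreal t)"
      using assms by (simp add: ext_stopping_time_def)
    show ?thesis by simp
  qed
  show ?thesis
    unfolding simple_point_process_def[abs_def] by (rule borel_measurable_suminf_order) (rule ind)
qed

theorem theorem2p2:
  fixes M :: "'a measure" and F :: "real \<Rightarrow> 'a measure"
    and T :: "nat \<Rightarrow> 'a \<Rightarrow> ennreal" and N :: "real \<Rightarrow> 'a \<Rightarrow> ennreal"
    and X :: "real \<Rightarrow> 'a \<Rightarrow> real"
  assumes "complete_filtered_prob_space M F"
    and "point_process_times M F T"
    and "N = simple_point_process T"
    and "nonneg_process M X"
    and "F0_measurable_process F X"
    and "locally_integrable M X"
  shows "conditional_poisson_process M F N X \<longleftrightarrow>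
         finite_process M N \<and> local_martingale M F (compensated_process N X)"
proof (cases "finite_process M N")
  case False
  then show ?thesis by (simp add: conditional_poisson_process_def)
next
  case fin: True
  interpret complete_filtered_prob_space M F by fact
  let ?N = "\<lambda>t \<omega>. enn2real (N t \<omega>)" and ?A = "\<lambda>t \<omega>. LBINT s:{0..t}. X s \<omega>"
  have space_F0: "space (F 0) = space M" using subalgebra_F[of 0] by (simp add: subalgebra_def)
  \<comment> \<open>Finiteness is given for each time separately. As the counts increase in time,
    integer times suffice, and for these a single null set serves.\<close>
  have "AE \<omega> in M. \<forall>k::nat. N (real k) \<omega> < \<infinity>"
    unfolding AE_all_countable using fin by (auto simp: finite_process_def)
  moreover have "AE \<omega> in M. \<forall>n. T (Suc n) \<omega> < \<infinity> \<longrightarrow> T n \<omega> < T (Suc n) \<omega>"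
    unfolding AE_all_countable using assms(2) by (simp add: point_process_times_def)
  ultimately have N_path: "AE \<omega> in M. simple_counting_path (\<lambda>t. ?N t \<omega>) \<and> cadlag (\<lambda>t. ?N t \<omega>)"
    unfolding assms(3)
    by eventually_elim (blast intro: simple_point_process_path simple_point_process_cadlag)
  have X_int: "AE \<omega> in M. (\<forall>t\<ge>0. set_integrable lborel {0..t} (\<lambda>s. X s \<omega>)) \<and> (\<forall>s\<ge>0. 0 \<le> X s \<omega>)"
    using assms(6)[unfolded locally_integrable_def] AE_space
  proof eventually_elim
    case (elim \<omega>)
    then have "0 \<le> X s \<omega>" if "0 \<le> s" for s using assms(4) that by (simp add: nonneg_process_def)
    with elim show ?case
      using F0_measurable_process_set_integrable[OF assms(5)] space_F0 by auto
  qed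
  interpret counting_compensator M F ?N ?A
  proof
    show "?N t \<in> borel_measurable (F t)" if t: "0 \<le> t" for t
    proof -
      have "N t \<in> borel_measurable (F t)"
        unfolding assms(3) using assms(2) t
        by (intro simple_point_process_measurable) (auto simp: point_process_times_def)
      then show ?thesis by measurable
    qed
    show "?A t \<in> borel_measurable (F 0)" for t
      by (rule F0_measurable_process_integral[OF assms(5)])
    show "AE \<omega> in M. compensator_path (\<lambda>t. ?A t \<omega>)"
      using X_int
    proof eventually_elim
      case (elim \<omega>)
      then show ?case by (intro compensator_path_set_integral) auto
    qed
  qed (use N_path subalgebra_F mono_F in auto)
  have "(AE \<omega> in M. complex_cond_exp M (F r) (\<lambda>\<omega>. exp (\<i> * of_real (u * (?N t \<omega> - ?N r \<omega>)))) \<omega>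
           = exp ((exp (\<i> * of_real u) - 1) * of_real (LBINT s:{r..t}. X s \<omega>))) \<longleftrightarrow>
        (AE \<omega> in M. complex_cond_exp M (F r) (\<lambda>\<omega>. exp (\<i> * of_real (u * (?N t \<omega> - ?N r \<omega>)))) \<omega>
           = exp ((exp (\<i> * of_real u) - 1) * of_real (?A t \<omega> - ?A r \<omega>)))"
    if rt: "0 \<le> r" "r \<le> t" for u r t
  proof -
    have "AE \<omega> in M. ?A t \<omega> - ?A r \<omega> = (LBINT s:{r..t}. X s \<omega>)"
      using X_int
    proof eventually_elim
      case (elim \<omega>)
      then show ?case using rt by (intro set_integral_diff_initial) auto
    qed
    then show ?thesis by (intro eventually_subst) (erule eventually_mono, simp only:)
  qed
  then have "conditional_poisson_process M F N X \<longleftrightarrow> characteristic_identity"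
    using fin unfolding conditional_poisson_process_def characteristic_identity_def by meson
  also have "\<dots> \<longleftrightarrow> mean_compensated"
    using characteristic_identity_imp_mean_compensated mean_compensated_imp_characteristic_identity by blast
  also have "\<dots> \<longleftrightarrow> local_martingale M F (compensated_process N X)"
    using mean_compensated_imp_local_martingale local_martingale_imp_mean_compensated
    by (auto simp: compensated_process_def[abs_def])
  finally show ?thesis using fin by simp
qed

end
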